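(* Let $K/k$ be q-finite of unbounded exponent and $i\in\mathbb{N}$. Then $K/k$ is $i$-modular if and only if $H_i(K/k)\sim K$. Moreover $dm(K/k)=\inf\{i\in\mathbb{N}: H_i(K/k)\sim K\}$.
   Context: Fields lie in an algebraic closure of $k$, characteristic $p>0$, extensions purely inseparable. q-finite: $\sup_n|G_n|<\infty$, $G_n$ a minimal generating set of $(k^{p^{-n}}\cap K)/k$. Relatively perfect: $k(K^p)=K$. Modular: for every $n$, $K^{p^n}$ and $k$ are $(k\cap K^{p^n})$-linearly disjoint; lq-modular: $K$ modular over a finite subextension. $H(K/L)$: largest subextension of $K/L$ that is lq-modular and relatively perfect over $L$. $H_0(K/k)=k$; for $i\ge1$, $H_i(K/k)=K$ if $K/H_{i-1}(K/k)$ is finite, and $H_i(K/k)=H(K/H_{i-1}(K/k))$ otherwise. $K/k$ is $i$-modular if there is a chain $k=F_0\subseteq F_1\subseteq\cdots\subseteq F_i=K$ with each $F_{j+1}/F_j$ lq-modular; $dm(K/k)$ is the least such $i$. $k_1\sim k_2$: one contains the other and the larger is finite over the smaller. *)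

theory Defs
  imports "HOL-Computational_Algebra.Primes" "HOL-Library.Extended_Nat"
begin

text \<open>All fields are subfields (given as carrier sets) of one ambient field of type 'a,
  whose characteristic is the prime p (expressed by the hypothesis of_nat p = 0).\<close>

definition subfield :: "'a::field set \<Rightarrow> bool" where
  "subfield F \<longleftrightarrow> 0 \<in> F \<and> 1 \<in> F \<and> (\<forall>x\<in>F. \<forall>y\<in>F. x + y \<in> F \<and> x * y \<in> F)
     \<and> (\<forall>x\<in>F. - x \<in> F) \<and> (\<forall>x\<in>F. x \<noteq> 0 \<longrightarrow> inverse x \<in> F)"

definition adjoin :: "'a::field set \<Rightarrow> 'a set \<Rightarrow> 'a set" where
  "adjoin F S = \<Inter>{E. subfield E \<and> F \<subseteq> E \<and> S \<subseteq> E}"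

definition field_ext :: "'a::field set \<Rightarrow> 'a set \<Rightarrow> bool" where
  "field_ext F L \<longleftrightarrow> subfield F \<and> subfield L \<and> F \<subseteq> L"

definition purely_insep :: "nat \<Rightarrow> 'a::field set \<Rightarrow> 'a set \<Rightarrow> bool" where
  "purely_insep p F L \<longleftrightarrow> field_ext F L \<and> (\<forall>x\<in>L. \<exists>n. x ^ (p ^ n) \<in> F)"

definition finite_ext :: "'a::field set \<Rightarrow> 'a set \<Rightarrow> bool" where
  "finite_ext F L \<longleftrightarrow> field_ext F L \<and>
     (\<exists>S. finite S \<and> S \<subseteq> L \<and> L \<subseteq> {\<Sum>s\<in>S. c s * s | c. \<forall>s. c s \<in> F})"

definition lin_indep :: "'a::field set \<Rightarrow> 'a set \<Rightarrow> bool" where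
  "lin_indep F S \<longleftrightarrow> (\<forall>T c. finite T \<longrightarrow> T \<subseteq> S \<longrightarrow> (\<forall>t\<in>T. c t \<in> F) \<longrightarrow>
      (\<Sum>t\<in>T. c t * t) = 0 \<longrightarrow> (\<forall>t\<in>T. c t = 0))"

definition lin_disjoint :: "'a::field set \<Rightarrow> 'a set \<Rightarrow> 'a set \<Rightarrow> bool" where
  "lin_disjoint F A B \<longleftrightarrow> (\<forall>S. S \<subseteq> A \<longrightarrow> lin_indep F S \<longrightarrow> lin_indep B S)"

definition pow_set :: "nat \<Rightarrow> 'a::field set \<Rightarrow> 'a set" where
  "pow_set q K = (\<lambda>x. x ^ q) ` K"

definition modular :: "nat \<Rightarrow> 'a::field set \<Rightarrow> 'a set \<Rightarrow> bool" where
  "modular p k K \<longleftrightarrow> (\<forall>n. lin_disjoint (k \<inter> pow_set (p ^ n) K) (pow_set (p ^ n) K) k)"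

definition lq_modular :: "nat \<Rightarrow> 'a::field set \<Rightarrow> 'a set \<Rightarrow> bool" where
  "lq_modular p k K \<longleftrightarrow> (\<exists>k'. field_ext k' K \<and> finite_ext k k' \<and> modular p k' K)"

definition rel_perfect :: "nat \<Rightarrow> 'a::field set \<Rightarrow> 'a set \<Rightarrow> bool" where
  "rel_perfect p k K \<longleftrightarrow> adjoin k (pow_set p K) = K"

definition H_good :: "nat \<Rightarrow> 'a::field set \<Rightarrow> 'a set \<Rightarrow> 'a set \<Rightarrow> bool" where
  "H_good p L K M \<longleftrightarrow> field_ext L M \<and> M \<subseteq> K \<and> lq_modular p L M \<and> rel_perfect p L M"

definition Hmax :: "nat \<Rightarrow> 'a::field set \<Rightarrow> 'a set \<Rightarrow> 'a set" where
  "Hmax p L K = (THE M. H_good p L K M \<and> (\<forall>M'. H_good p L K M' \<longrightarrow> M' \<subseteq> M))"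

primrec Hseq :: "nat \<Rightarrow> 'a::field set \<Rightarrow> 'a set \<Rightarrow> nat \<Rightarrow> 'a set" where
  "Hseq p k K 0 = k"
| "Hseq p k K (Suc i) =
     (if finite_ext (Hseq p k K i) K then K else Hmax p (Hseq p k K i) K)"

definition i_modular :: "nat \<Rightarrow> 'a::field set \<Rightarrow> 'a set \<Rightarrow> nat \<Rightarrow> bool" where
  "i_modular p k K i \<longleftrightarrow> (\<exists>F :: nat \<Rightarrow> 'a set. F 0 = k \<and> F i = K \<and>
      (\<forall>j<i. field_ext (F j) (F (Suc j)) \<and> lq_modular p (F j) (F (Suc j))))"

definition dm :: "nat \<Rightarrow> 'a::field set \<Rightarrow> 'a set \<Rightarrow> enat" where
  "dm p k K = (if \<exists>i. i_modular p k K i then enat (LEAST i. i_modular p k K i) else \<infinity>)"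

definition equiv_fin :: "'a::field set \<Rightarrow> 'a set \<Rightarrow> bool" (infix "\<sim>\<^sub>f" 50) where
  "k1 \<sim>\<^sub>f k2 \<longleftrightarrow> finite_ext k1 k2 \<or> finite_ext k2 k1"

definition min_gen :: "'a::field set \<Rightarrow> 'a set \<Rightarrow> 'a set \<Rightarrow> bool" where
  "min_gen F L G \<longleftrightarrow> G \<subseteq> L \<and> adjoin F G = L \<and> (\<forall>G'. G' \<subset> G \<longrightarrow> adjoin F G' \<noteq> L)"

definition root_part :: "nat \<Rightarrow> 'a::field set \<Rightarrow> 'a set \<Rightarrow> nat \<Rightarrow> 'a set" where
  "root_part p k K n = {x\<in>K. x ^ (p ^ n) \<in> k}"

definition q_finite :: "nat \<Rightarrow> 'a::field set \<Rightarrow> 'a set \<Rightarrow> bool" where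
  "q_finite p k K \<longleftrightarrow> (\<exists>B::nat. \<forall>n. \<exists>G. min_gen k (root_part p k K n) G \<and> finite G \<and> card G \<le> B)"

definition unbounded_exponent :: "nat \<Rightarrow> 'a::field set \<Rightarrow> 'a set \<Rightarrow> bool" where
  "unbounded_exponent p k K \<longleftrightarrow> \<not> (\<exists>e. \<forall>x\<in>K. x ^ (p ^ e) \<in> k)"

end

theory Submission
  imports Defs
begin

text \<open>Let \<open>K_m\<close> be the \<open>m\<close>-th root part of \<open>K/k\<close>. Counting degrees, q-finiteness bounds \<open>[N : k(N^p)]\<close> for
  every intermediate field \<open>N\<close>, so \<open>A_m = \<Inter>j. k(K_(m+j)^(p^j))\<close> is an eventually constant intersection,
  \<open>k(A_(m+1)^p) = A_m\<close>, and the degrees \<open>[A_(m+1) : A_m]\<close> are nondecreasing and bounded. Once they are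
  constant the union \<open>H\<close> of the \<open>A_m\<close> is modular over \<open>A_m\<close>; the same argument applies to \<open>H(G)\<close> for finite
  \<open>G\<close>. Conversely, if \<open>N\<close> is modular over \<open>F'\<close> and \<open>F'^(p^c) \<subseteq> k\<close>, then \<open>x^(p^c) \<in> H\<close> for every \<open>x\<close> lying
  in all \<open>F'(N^(p^j))\<close>. Hence \<open>H = H(K/k)\<close>.

  By induction, a chain \<open>F_j\<close> of lq-modular steps satisfies \<open>F_j \<subseteq> H_j(G_j)\<close> with \<open>G_j\<close> finite, which gives
  one direction. For the other, cut the sequence \<open>H_j\<close> at the first index with \<open>K/H_j\<close> finite: then
  \<open>K = H_j(G)\<close> is lq-modular over \<open>H_(j-1)\<close>.\<close>


section \<open>Linear algebra over a subfield\<close>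

lemma subfieldD:
  assumes "subfield F"
  shows "0 \<in> F" "1 \<in> F" "\<And>x y. x \<in> F \<Longrightarrow> y \<in> F \<Longrightarrow> x + y \<in> F"
    "\<And>x y. x \<in> F \<Longrightarrow> y \<in> F \<Longrightarrow> x * y \<in> F" "\<And>x. x \<in> F \<Longrightarrow> - x \<in> F"
    "\<And>x. x \<in> F \<Longrightarrow> inverse x \<in> F" "\<And>x y. x \<in> F \<Longrightarrow> y \<in> F \<Longrightarrow> x - y \<in> F"
proof -
  show "x - y \<in> F" if "x \<in> F" "y \<in> F" for x y
    using assms that unfolding subfield_def by (metis diff_conv_add_uminus)
  show "inverse x \<in> F" if "x \<in> F" for x
    using assms that unfolding subfield_def by (metis inverse_zero)
qed (use assms in \<open>auto simp: subfield_def\<close>)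

lemma subfield_power: "subfield F \<Longrightarrow> x \<in> F \<Longrightarrow> x ^ n \<in> F"
  by (induction n) (auto simp: subfieldD)

lemma subfield_sum: "subfield F \<Longrightarrow> (\<And>t. t \<in> T \<Longrightarrow> f t \<in> F) \<Longrightarrow> sum f T \<in> F"
  by (induction T rule: infinite_finite_induct) (auto simp: subfieldD)

text \<open>The span grows by one summand at a time, so linear statements follow by induction
  without coefficient functions; \<open>lspan_finite_sum\<close> recovers the finite sums that occur
  in \<open>lin_indep\<close>.\<close>

inductive_set lspan :: "'a::field set \<Rightarrow> 'a set \<Rightarrow> 'a set" for F S where
  lspan_zero: "0 \<in> lspan F S"
| lspan_step: "c \<in> F \<Longrightarrow> s \<in> S \<Longrightarrow> v \<in> lspan F S \<Longrightarrow> c * s + v \<in> lspan F S"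

lemma lspan_add: "u \<in> lspan F S \<Longrightarrow> v \<in> lspan F S \<Longrightarrow> u + v \<in> lspan F S"
  by (induction rule: lspan.induct) (auto simp: add.assoc intro: lspan.intros)

lemma lspan_scale:
  assumes "subfield F" "c \<in> F" "v \<in> lspan F S"
  shows "c * v \<in> lspan F S"
  using assms(3)
proof induction
  case (lspan_step d s v)
  have "c * d \<in> F" using assms lspan_step by (simp add: subfieldD)
  from lspan.lspan_step[OF this lspan_step(2,4)] show ?case by (simp add: distrib_left mult.assoc)
qed (simp add: lspan_zero)

lemma lspan_unscale:
  assumes "subfield F" "c \<in> F" "c \<noteq> 0" "c * v \<in> lspan F S"
  shows "v \<in> lspan F S"
proof -
  have "inverse c * (c * v) \<in> lspan F S" using assms by (auto intro!: lspan_scale[of F "inverse c"] simp: subfieldD)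
  thus ?thesis using assms(3) by (simp add: mult.assoc[symmetric])
qed

lemma lspan_base: "subfield F \<Longrightarrow> s \<in> S \<Longrightarrow> s \<in> lspan F S"
  using lspan_step[of 1 F s S 0] by (simp add: lspan_zero subfieldD)

lemma lspan_mult: "subfield F \<Longrightarrow> c \<in> F \<Longrightarrow> s \<in> S \<Longrightarrow> c * s \<in> lspan F S"
  by (simp add: lspan_base lspan_scale)

lemma lspan_diff: "subfield F \<Longrightarrow> u \<in> lspan F S \<Longrightarrow> v \<in> lspan F S \<Longrightarrow> u - v \<in> lspan F S"
  using lspan_add[of u F S "-1 * v"] lspan_scale[of F "-1" v S] by (simp add: subfieldD)

lemma lspan_sum: "(\<And>t. t \<in> T \<Longrightarrow> f t \<in> lspan F S) \<Longrightarrow> sum f T \<in> lspan F S"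
  by (induction T rule: infinite_finite_induct) (auto simp: lspan_zero lspan_add)

lemma lspan_minimal:
  assumes "0 \<in> W" "\<And>u v. u \<in> W \<Longrightarrow> v \<in> W \<Longrightarrow> u + v \<in> W" "\<And>c s. c \<in> F \<Longrightarrow> s \<in> S \<Longrightarrow> c * s \<in> W"
  shows "lspan F S \<subseteq> W"
proof
  show "x \<in> W" if "x \<in> lspan F S" for x using that by induction (auto intro: assms)
qed

lemma lspan_mono: "F \<subseteq> F' \<Longrightarrow> S \<subseteq> S' \<Longrightarrow> lspan F S \<subseteq> lspan F' S'"
proof
  show "x \<in> lspan F' S'" if "F \<subseteq> F'" "S \<subseteq> S'" "x \<in> lspan F S" for x
    using that(3) by induction (use that in \<open>auto intro: lspan.intros\<close>)
qed

lemma lspan_trans: "subfield F \<Longrightarrow> S \<subseteq> lspan F T \<Longrightarrow> lspan F S \<subseteq> lspan F T"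
  by (rule lspan_minimal) (auto intro: lspan_zero lspan_add lspan_scale)

lemma lspan_in_subfield: "subfield E \<Longrightarrow> F \<subseteq> E \<Longrightarrow> S \<subseteq> E \<Longrightarrow> lspan F S \<subseteq> E"
  by (rule lspan_minimal) (auto simp: subfieldD subset_iff)

lemma lspan_self: "subfield E \<Longrightarrow> subfield F \<Longrightarrow> F \<subseteq> E \<Longrightarrow> lspan F E = E"
  by (simp add: lspan_base lspan_in_subfield subset_antisym subsetI)

lemma lspan_finite_sum:
  assumes "subfield F" "x \<in> lspan F S"
  shows "\<exists>T c. finite T \<and> T \<subseteq> S \<and> (\<forall>t. c t \<in> F) \<and> x = (\<Sum>t\<in>T. c t * t)"
  using assms(2)
proof induction
  case lspan_zero
  show ?case by (rule exI[of _ "{}"], rule exI[of _ "\<lambda>_. 0"]) (simp add: assms subfieldD)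
next
  case (lspan_step a s v)
  then obtain T c where T: "finite T" "T \<subseteq> S" "\<forall>t. c t \<in> F" "v = (\<Sum>t\<in>T. c t * t)" by auto
  \<comment> \<open>\<open>s\<close> may already belong to \<open>T\<close>, so \<open>a\<close> is
    added to its old coefficient; \<open>c\<close> is cut off outside \<open>T\<close> because it
    need not vanish there.\<close>
  let ?c = "\<lambda>t. (if t = s then a else 0) + (if t \<in> T then c t else 0)"
  have "(\<Sum>t\<in>insert s T. ?c t * t) = (\<Sum>t\<in>insert s T. (if t = s then a * t else 0)) + (\<Sum>t\<in>insert s T. (if t \<in> T then c t * t else 0))"
    unfolding sum.distrib[symmetric] by (rule sum.cong) (auto simp: distrib_right)
  also have "(\<Sum>t\<in>insert s T. (if t = s then a * t else 0)) = a * s"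
    using T(1) by (simp add: sum.delta)
  also have "(\<Sum>t\<in>insert s T. (if t \<in> T then c t * t else 0)) = v"
    unfolding T(4) using T(1) by (intro sum.mono_neutral_cong_right) auto
  finally have "a * s + v = (\<Sum>t\<in>insert s T. ?c t * t)" by simp
  moreover have "\<forall>t. ?c t \<in> F" using T lspan_step assms by (auto simp: subfieldD)
  ultimately show ?case using T lspan_step by (intro exI[of _ "insert s T"] exI[of _ ?c]) auto
qed

lemma lspan_finite_subset:
  assumes "subfield F" "x \<in> lspan F S"
  shows "\<exists>T. finite T \<and> T \<subseteq> S \<and> x \<in> lspan F T"
proof -
  obtain T c where T: "finite T" "T \<subseteq> S" "\<forall>t. c t \<in> F" "x = (\<Sum>t\<in>T. c t * t)"
    using lspan_finite_sum[OF assms] by auto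
  have "x \<in> lspan F T" unfolding T(4) by (rule lspan_sum) (use T assms in \<open>auto intro: lspan_mult\<close>)
  thus ?thesis using T by auto
qed

lemma lspan_insert_iff:
  assumes "subfield F"
  shows "x \<in> lspan F (insert a S) \<longleftrightarrow> (\<exists>c\<in>F. x - c * a \<in> lspan F S)"
proof
  assume "x \<in> lspan F (insert a S)"
  thus "\<exists>c\<in>F. x - c * a \<in> lspan F S"
  proof induction
    case lspan_zero thus ?case using assms by (intro bexI[of _ 0]) (auto intro: lspan.intros subfieldD)
  next
    case (lspan_step c s v)
    then obtain d where d: "d \<in> F" "v - d * a \<in> lspan F S" by auto
    show ?case
    proof (cases "s = a")
      case True
      have "c * s + v - (c + d) * a = v - d * a" using True by (simp add: algebra_simps)
      hence "c * s + v - (c + d) * a \<in> lspan F S" using d by (simp only:)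
      moreover have "c + d \<in> F" using d lspan_step assms by (auto intro: subfieldD)
      ultimately show ?thesis by blast
    next
      case False
      have "c * s + v - d * a = c * s + (v - d * a)" by (simp add: algebra_simps)
      moreover have "c * s + (v - d * a) \<in> lspan F S"
        using False d lspan_step by (intro lspan.lspan_step) auto
      ultimately have "c * s + v - d * a \<in> lspan F S" by (simp only:)
      thus ?thesis using d(1) by blast
    qed
  qed
next
  assume "\<exists>c\<in>F. x - c * a \<in> lspan F S"
  then obtain c where c: "c \<in> F" "x - c * a \<in> lspan F S" by auto
  have "x - c * a \<in> lspan F (insert a S)" using c lspan_mono[of F F S "insert a S"] by auto
  from lspan_step[OF c(1) _ this, of a] show "x \<in> lspan F (insert a S)" by simp
qed

section \<open>Linear independence and exchange\<close>

lemma lin_indep_subset: "lin_indep F S \<Longrightarrow> T \<subseteq> S \<Longrightarrow> lin_indep F T"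
  unfolding lin_indep_def by blast

lemma lin_indep_antimono: "lin_indep F S \<Longrightarrow> F' \<subseteq> F \<Longrightarrow> lin_indep F' S"
  unfolding lin_indep_def by (meson subsetD)

lemma lin_indep_finite_subsets: "(\<And>T. finite T \<Longrightarrow> T \<subseteq> S \<Longrightarrow> lin_indep F T) \<Longrightarrow> lin_indep F S"
  unfolding lin_indep_def by (meson order_refl)

lemma lin_indep_iff:
  assumes F: "subfield F"
  shows "lin_indep F S \<longleftrightarrow> (\<forall>s\<in>S. s \<notin> lspan F (S - {s}))"
proof (intro iffI ballI notI)
  fix s assume ind: "lin_indep F S" and s: "s \<in> S" "s \<in> lspan F (S - {s})"
  obtain T c where T: "finite T" "T \<subseteq> S - {s}" "\<forall>t. c t \<in> F" "s = (\<Sum>t\<in>T. c t * t)"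
    using lspan_finite_sum[OF F s(2)] by auto
  let ?c = "c(s := - 1)"
  have "(\<Sum>t\<in>T. ?c t * t) = s"
    unfolding T(4)[symmetric] by (subst T(4), rule sum.cong) (use T(2) in auto)
  moreover have "s \<notin> T" using T(2) by auto
  ultimately have "(\<Sum>t\<in>insert s T. ?c t * t) = 0" using T(1) by simp
  moreover have "\<forall>t\<in>insert s T. ?c t \<in> F" using T(3) F by (auto simp: subfieldD)
  moreover have "finite (insert s T)" "insert s T \<subseteq> S" using T s by auto
  ultimately have "?c s = 0" using ind unfolding lin_indep_def by blast
  thus False by simp
next
  assume R: "\<forall>s\<in>S. s \<notin> lspan F (S - {s})"
  show "lin_indep F S" unfolding lin_indep_def
  proof (intro allI impI ballI, rule ccontr)
    fix T c t assume T: "finite T" "T \<subseteq> S" "\<forall>t\<in>T. c t \<in> F" "(\<Sum>t\<in>T. c t * t) = 0" "t \<in> T" "c t \<noteq> 0"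
    have "c t * t = - (\<Sum>u\<in>T-{t}. c u * u)"
      using T by (simp add: sum.remove[of T t] eq_neg_iff_add_eq_0)
    hence "t = - inverse (c t) * (\<Sum>u\<in>T-{t}. c u * u)" using T(6) by (simp add: field_simps)
    moreover have "(\<Sum>u\<in>T-{t}. c u * u) \<in> lspan F (S - {t})"
      by (rule lspan_sum) (use T F in \<open>auto intro!: lspan_mult\<close>)
    hence "- inverse (c t) * (\<Sum>u\<in>T-{t}. c u * u) \<in> lspan F (S - {t})"
      using F T by (intro lspan_scale) (auto intro!: subfieldD(5,6))
    ultimately show False using R T by auto
  qed
qed

lemma lin_indep_insert:
  assumes F: "subfield F" and "lin_indep F S" "a \<notin> lspan F S"
  shows "lin_indep F (insert a S)"
  unfolding lin_indep_iff[OF F]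
proof (intro ballI notI)
  fix s assume s: "s \<in> insert a S" "s \<in> lspan F (insert a S - {s})"
  show False
  proof (cases "s = a")
    case True
    thus False using s assms(3) lspan_mono[of F F "insert a S - {a}" S] by auto
  next
    case False
    hence "s \<in> lspan F (insert a (S - {s}))" using s by (simp add: insert_Diff_if)
    then obtain c where c: "c \<in> F" "s - c * a \<in> lspan F (S - {s})" using lspan_insert_iff[OF F] by auto
    show False
    proof (cases "c = 0")
      case True thus False using c assms(2) False s unfolding lin_indep_iff[OF F] by auto
    next
      case False
      have "s - c * a \<in> lspan F S" using c lspan_mono[of F F "S - {s}" S] by auto
      from lspan_diff[OF F lspan_base[OF F] this, of s] have "c * a \<in> lspan F S" using s \<open>s \<noteq> a\<close> by auto
      thus False using lspan_unscale[OF F c(1) False] assms(3) by blast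
    qed
  qed
qed

lemma lin_indep_insertD: "subfield F \<Longrightarrow> lin_indep F (insert a S) \<Longrightarrow> a \<notin> S \<Longrightarrow> a \<notin> lspan F S"
  by (auto simp: lin_indep_iff)

text \<open>Elements of \<open>X\<close> are dropped one at a time until \<open>y\<close> leaves the
  span. The one dropped at that moment has a nonzero coefficient in \<open>y\<close>, so the
  relation can be solved for it.\<close>

lemma lspan_exchange:
  assumes F: "subfield F" and "finite X" "y \<in> lspan F (Y \<union> X)" "y \<notin> lspan F Y"
  shows "\<exists>x\<in>X. x \<in> lspan F (insert y (Y \<union> (X - {x})))"
  using assms(2,3)
proof (induction X)
  case empty thus ?case using assms(4) by simp
next
  case (insert x X)
  show ?case
  proof (cases "y \<in> lspan F (Y \<union> X)")
    case True
    then obtain z where z: "z \<in> X" "z \<in> lspan F (insert y (Y \<union> (X - {z})))" using insert by auto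
    moreover have "insert y (Y \<union> (X - {z})) \<subseteq> insert y (Y \<union> (insert x X - {z}))" by auto
    ultimately show ?thesis using lspan_mono[OF order_refl] by blast
  next
    case False
    obtain c where c: "c \<in> F" "y - c * x \<in> lspan F (Y \<union> X)"
      using insert lspan_insert_iff[OF F, of y x] by auto
    have "c \<noteq> 0" using c False by auto
    have "y - c * x \<in> lspan F (insert y (Y \<union> X))" using c lspan_mono[of F F "Y \<union> X"] by blast
    from lspan_diff[OF F lspan_base[OF F] this, of y] have "c * x \<in> lspan F (insert y (Y \<union> X))" by simp
    hence "x \<in> lspan F (insert y (Y \<union> X))" using lspan_unscale[OF F c(1) \<open>c \<noteq> 0\<close>] by blast
    moreover have "insert x X - {x} = X" using insert by auto
    ultimately show ?thesis by auto
  qed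
qed

text \<open>Each new \<open>y\<close> displaces one element of the surviving \<open>X'\<close>;
  independence keeps \<open>y\<close> outside \<open>lspan F Y\<close>, so the displaced element can
  be taken from \<open>X'\<close> and not from \<open>Y\<close>.\<close>

lemma steinitz_finite:
  assumes F: "subfield F" and X: "finite X" and "finite Y" "lin_indep F Y" "Y \<subseteq> lspan F X"
  shows "\<exists>X'\<subseteq>X. card X' + card Y = card X \<and> X \<subseteq> lspan F (Y \<union> X')"
  using assms(3-)
proof (induction Y)
  case empty thus ?case using F by (intro exI[of _ X]) (auto intro: lspan_base)
next
  case (insert y Y)
  have "lin_indep F Y" using insert lin_indep_subset by blast
  then obtain X' where X': "X' \<subseteq> X" "card X' + card Y = card X" "X \<subseteq> lspan F (Y \<union> X')"
    using insert by auto
  have fX': "finite X'" using X X' finite_subset by auto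
  have "y \<in> lspan F (Y \<union> X')" using insert.prems lspan_trans[OF F X'(3)] by auto
  moreover have "y \<notin> lspan F Y" using insert lin_indep_insertD[OF F] by auto
  ultimately obtain x where x: "x \<in> X'" "x \<in> lspan F (insert y (Y \<union> (X' - {x})))"
    using lspan_exchange[OF F fX'] by blast
  have "Y \<union> X' \<subseteq> lspan F (insert y (Y \<union> (X' - {x})))"
  proof
    fix z assume "z \<in> Y \<union> X'"
    thus "z \<in> lspan F (insert y (Y \<union> (X' - {x})))"
      using x(2) F by (cases "z = x") (auto intro: lspan_base)
  qed
  hence "X \<subseteq> lspan F (insert y Y \<union> (X' - {x}))"
    using subset_trans[OF X'(3) lspan_trans[OF F]] by simp
  moreover have "card (X' - {x}) + card (insert y Y) = card X"
    using X'(2) x fX' insert.hyps card_gt_0_iff[of X'] by (auto simp: card_Diff_singleton)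
  ultimately show ?case using X' by (intro exI[of _ "X' - {x}"]) auto
qed

lemma steinitz:
  assumes F: "subfield F" and X: "finite X" and Y: "lin_indep F Y" "Y \<subseteq> lspan F X"
  shows "finite Y \<and> card Y \<le> card X"
proof -
  have le: "card Z \<le> card X" if "finite Z" "Z \<subseteq> Y" for Z
  proof -
    have "Z \<subseteq> lspan F X" using that Y by auto
    from steinitz_finite[OF F X that(1) lin_indep_subset[OF Y(1) that(2)] this] show ?thesis by auto
  qed
  have "finite Y"
  proof (rule ccontr)
    assume "infinite Y"
    then obtain Z where "finite Z" "card Z = Suc (card X)" "Z \<subseteq> Y" using infinite_arbitrarily_large by metis
    thus False using le[of Z] by simp
  qed
  thus ?thesis using le by auto
qed

section \<open>Bases and dimension\<close>

definition basis :: "'a::field set \<Rightarrow> 'a set \<Rightarrow> 'a set \<Rightarrow> bool" where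
  "basis F V B \<longleftrightarrow> finite B \<and> lin_indep F B \<and> lspan F B = V"

definition fin_dim :: "'a::field set \<Rightarrow> 'a set \<Rightarrow> bool" where
  "fin_dim F V \<longleftrightarrow> (\<exists>B. basis F V B)"

text \<open>The choice of basis is immaterial by \<open>basis_fdim\<close>; the value is meaningful
  only under \<open>fin_dim\<close>.\<close>

definition fdim :: "'a::field set \<Rightarrow> 'a set \<Rightarrow> nat" where
  "fdim F V = card (SOME B. basis F V B)"

lemma basis_fdim:
  assumes "subfield F" "basis F V B" shows "card B = fdim F V"
proof -
  have "basis F V (SOME B. basis F V B)" using assms(2) by (rule someI)
  thus ?thesis using assms(2) steinitz[OF assms(1), of _ B] steinitz[OF assms(1), of B] lspan_base[OF assms(1)]
    unfolding basis_def fdim_def by (intro le_antisym) blast+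
qed

lemma fin_dim_basis: "subfield F \<Longrightarrow> fin_dim F V \<Longrightarrow> \<exists>B. basis F V B \<and> card B = fdim F V"
  using basis_fdim fin_dim_def by blast

lemma basis_extend:
  assumes F: "subfield F" and S: "finite S" "lin_indep F S" and X: "finite X"
  shows "\<exists>B. S \<subseteq> B \<and> B \<subseteq> S \<union> X \<and> basis F (lspan F (S \<union> X)) B"
  using X
proof (induction X)
  case empty thus ?case using S by (auto simp: basis_def)
next
  case (insert x X)
  then obtain B where B: "S \<subseteq> B" "B \<subseteq> S \<union> X" "basis F (lspan F (S \<union> X)) B" by auto
  show ?case
  proof (cases "x \<in> lspan F B")
    case True
    have "S \<union> insert x X \<subseteq> lspan F B" using True B F unfolding basis_def by (auto intro: lspan_base)
    hence "lspan F (S \<union> insert x X) = lspan F B"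
      using B F by (intro subset_antisym lspan_trans lspan_mono) auto
    thus ?thesis using B by (intro exI[of _ B]) (auto simp: basis_def)
  next
    case False
    hence "lin_indep F (insert x B)" using B F unfolding basis_def by (intro lin_indep_insert) auto
    moreover have "S \<union> insert x X \<subseteq> lspan F (insert x B)"
      using B(3) lspan_base[OF F] lspan_mono[of F F B "insert x B"] unfolding basis_def by blast
    hence "lspan F (S \<union> insert x X) = lspan F (insert x B)"
      using B F by (intro subset_antisym lspan_trans lspan_mono) auto
    ultimately show ?thesis using B by (intro exI[of _ "insert x B"]) (auto simp: basis_def)
  qed
qed

lemma fin_dim_lspan: "subfield F \<Longrightarrow> finite X \<Longrightarrow> fin_dim F (lspan F X) \<and> fdim F (lspan F X) \<le> card X"
proof -
  assume F: "subfield F" and X: "finite X"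
  have "lin_indep F {}" by (simp add: lin_indep_def)
  from basis_extend[OF F _ this X] obtain B where "B \<subseteq> X" "basis F (lspan F X) B" by auto
  thus ?thesis using basis_fdim[OF F] card_mono[OF X, of B] unfolding fin_dim_def by auto
qed

lemma lin_indep_card_le:
  assumes "subfield F" "fin_dim F V" "lin_indep F S" "S \<subseteq> V"
  shows "finite S \<and> card S \<le> fdim F V"
proof -
  obtain B where B: "basis F V B" "card B = fdim F V" using fin_dim_basis[OF assms(1,2)] by auto
  show ?thesis using steinitz[OF assms(1) _ assms(3), of B] B assms(4) by (auto simp: basis_def)
qed

lemma fin_dim_extend:
  assumes F: "subfield F" "fin_dim F V" "lin_indep F S" "S \<subseteq> V"
  shows "\<exists>B. S \<subseteq> B \<and> basis F V B"
proof -
  obtain X where X: "basis F V X" using assms(2) by (auto simp: fin_dim_def)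
  have "finite S" using lin_indep_card_le[OF assms] by simp
  then obtain B where "S \<subseteq> B" "basis F (lspan F (S \<union> X)) B"
    using basis_extend[OF F(1) _ F(3), of X] X unfolding basis_def by auto
  moreover have "lspan F (S \<union> X) = V"
    using X assms lspan_mono[of F F X "S \<union> X"] lspan_trans[OF F(1), of "S \<union> X" X]
    unfolding basis_def by (auto intro: lspan_base)
  ultimately show ?thesis by auto
qed

text \<open>An independent subset of \<open>V\<close> of greatest cardinality spans
  \<open>V\<close>, since a vector outside its span could be added. This gives finite dimension
  where only finite independent sets can be controlled.\<close>

lemma fin_dim_bounded:
  assumes F: "subfield F" and V: "lspan F V = V"
    and le: "\<And>S. finite S \<Longrightarrow> S \<subseteq> V \<Longrightarrow> lin_indep F S \<Longrightarrow> card S \<le> n"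
  shows "fin_dim F V \<and> fdim F V \<le> n"
proof -
  let ?P = "\<lambda>m. \<exists>S. finite S \<and> S \<subseteq> V \<and> lin_indep F S \<and> card S = m"
  have P0: "?P 0" by (intro exI[of _ "{}"]) (auto simp: lin_indep_def)
  have bd: "\<forall>m. ?P m \<longrightarrow> m \<le> n" using le by auto
  obtain S where S: "finite S" "S \<subseteq> V" "lin_indep F S" "card S = Greatest ?P"
    using GreatestI_nat[of ?P, OF P0] bd by blast
  have "V \<subseteq> lspan F S"
  proof (rule ccontr)
    assume "\<not> V \<subseteq> lspan F S"
    then obtain a where a: "a \<in> V" "a \<notin> lspan F S" by auto
    have "a \<notin> S" using a lspan_base[OF F] by auto
    hence "?P (Suc (Greatest ?P))"
      using a S lin_indep_insert[OF F S(3) a(2)] by (intro exI[of _ "insert a S"]) auto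
    hence "Suc (Greatest ?P) \<le> Greatest ?P" using bd by (intro Greatest_le_nat[of ?P _ n]) auto
    thus False by simp
  qed
  hence "lspan F S = V" using S lspan_mono[of F F S V] V by auto
  hence "basis F V S" using S by (auto simp: basis_def)
  thus ?thesis using le[OF S(1-3)] basis_fdim[OF F, of V S] unfolding fin_dim_def by auto
qed

lemma fin_dim_subspace:
  assumes F: "subfield F" and V: "lspan F V = V" and W: "fin_dim F W" and sub: "V \<subseteq> W"
  shows "fin_dim F V \<and> fdim F V \<le> fdim F W"
  using lin_indep_card_le[OF F W] sub by (intro fin_dim_bounded[OF F V]) auto

lemma fdim_eq_imp_eq:
  assumes F: "subfield F" and V: "fin_dim F V" and W: "fin_dim F W" and sub: "V \<subseteq> W" "fdim F V = fdim F W"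
  shows "V = W"
proof -
  obtain B where B: "basis F V B" "card B = fdim F V" using fin_dim_basis[OF F V] by auto
  have "B \<subseteq> W" using B sub F unfolding basis_def by (auto intro: lspan_base)
  then obtain B' where B': "B \<subseteq> B'" "basis F W B'" using fin_dim_extend[OF F W, of B] B by (auto simp: basis_def)
  have "card B = card B'" using B(2) sub(2) basis_fdim[OF F B'(2)] by simp
  hence "B = B'" using card_subset_eq[of B' B] B' by (simp add: basis_def)
  thus ?thesis using B B' by (auto simp: basis_def)
qed

lemma finite_ext_iff: "finite_ext F L \<longleftrightarrow> field_ext F L \<and> fin_dim F L"
proof
  assume L: "finite_ext F L"
  then obtain S where S: "finite S" "S \<subseteq> L" "L \<subseteq> {\<Sum>s\<in>S. c s * s | c. \<forall>s. c s \<in> F}"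
    and e: "field_ext F L" by (auto simp: finite_ext_def)
  have F: "subfield F" "subfield L" "F \<subseteq> L" using e by (auto simp: field_ext_def)
  have "L \<subseteq> lspan F S" using S F by (force intro!: lspan_sum lspan_mult)
  hence "lspan F S = L" using lspan_in_subfield[OF F(2,3) S(2)] by auto
  thus "field_ext F L \<and> fin_dim F L" using fin_dim_lspan[OF F(1) S(1)] e by auto
next
  assume R: "field_ext F L \<and> fin_dim F L"
  hence F: "subfield F" by (auto simp: field_ext_def)
  obtain B where B: "finite B" "lspan F B = L" using R unfolding fin_dim_def basis_def by auto
  have "L \<subseteq> {\<Sum>s\<in>B. c s * s | c. \<forall>s. c s \<in> F}"
  proof
    fix x assume "x \<in> L"
    then obtain T c where T: "finite T" "T \<subseteq> B" "\<forall>t. c t \<in> F" "x = (\<Sum>t\<in>T. c t * t)"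
      using lspan_finite_sum[OF F, of x B] B by auto
    have "x = (\<Sum>s\<in>B. (if s \<in> T then c s else 0) * s)"
      unfolding T(4) using T B by (intro sum.mono_neutral_cong_left) auto
    thus "x \<in> {\<Sum>s\<in>B. c s * s | c. \<forall>s. c s \<in> F}"
      using T F by (auto intro!: exI[of _ "\<lambda>s. if s \<in> T then c s else 0"] simp: subfieldD)
  qed
  thus "finite_ext F L" using R B lspan_base[OF F] unfolding finite_ext_def by blast
qed


text \<open>Injectivity comes for free: \<open>g i = g j\<close> would give a relation with
  coefficients \<open>1\<close> and \<open>-1\<close>. This serves the products of basis elements in
  \<open>fdim_tower\<close>.\<close>

lemma lin_indep_image:
  fixes g :: "'i \<Rightarrow> 'a::field"
  assumes F: "subfield F" and I: "finite I"
    and ind: "\<And>c. (\<And>i. i \<in> I \<Longrightarrow> c i \<in> F) \<Longrightarrow> (\<Sum>i\<in>I. c i * g i) = 0 \<Longrightarrow> (\<forall>i\<in>I. c i = 0)"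
  shows "inj_on g I \<and> lin_indep F (g ` I)"
proof
  show inj: "inj_on g I"
  proof (rule inj_onI, rule ccontr)
    fix i j assume ij: "i \<in> I" "j \<in> I" "g i = g j" "i \<noteq> j"
    let ?c = "\<lambda>x. if x = i then 1 else if x = j then -1 else (0::'a)"
    have "(\<Sum>x\<in>I. ?c x * g x) = (\<Sum>x\<in>{i,j}. ?c x * g x)"
      using I ij by (intro sum.mono_neutral_right) auto
    also have "\<dots> = 0" using ij by simp
    finally have "\<forall>x\<in>I. ?c x = 0" using F by (intro ind) (auto simp: subfieldD)
    thus False using ij(1) by auto
  qed
  show "lin_indep F (g ` I)" unfolding lin_indep_def
  proof (intro allI impI ballI)
    fix T c t assume T: "finite T" "T \<subseteq> g ` I" "\<forall>t\<in>T. c t \<in> F" "(\<Sum>t\<in>T. c t * t) = 0" "t \<in> T"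
    let ?c = "\<lambda>i. if g i \<in> T then c (g i) else 0"
    have "(\<Sum>i\<in>I. ?c i * g i) = (\<Sum>t\<in>g ` I. (if t \<in> T then c t else 0) * t)"
      by (subst sum.reindex[OF inj]) simp
    also have "\<dots> = (\<Sum>t\<in>T. c t * t)"
      using T I by (intro sum.mono_neutral_cong_right) auto
    finally have "(\<Sum>i\<in>I. ?c i * g i) = 0" using T(4) by simp
    hence "\<forall>i\<in>I. ?c i = 0" using F T(3) by (intro ind) (auto simp: subfieldD)
    thus "c t = 0" using T(2,5) by force
  qed
qed

lemma lin_indepD:
  assumes "lin_indep F A" "finite A" "\<And>a. a \<in> A \<Longrightarrow> c a \<in> F" "(\<Sum>a\<in>A. c a * a) = 0" "a \<in> A"
  shows "c a = 0"
proof -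
  have "\<forall>t\<in>A. c t = 0"
    using assms(1)[unfolded lin_indep_def, rule_format, of A c] assms by blast
  thus ?thesis using assms(5) by blast
qed

lemma fdim_tower:
  assumes F: "subfield F" and E: "subfield E" and FE: "fin_dim F E" and EV: "fin_dim E V"
  shows "fin_dim F V \<and> fdim F V = fdim F E * fdim E V"
proof -
  obtain A where A: "finite A" "lin_indep F A" "lspan F A = E" "card A = fdim F E"
    using fin_dim_basis[OF F FE] by (auto simp: basis_def)
  obtain B where B: "finite B" "lin_indep E B" "lspan E B = V" "card B = fdim E V"
    using fin_dim_basis[OF E EV] by (auto simp: basis_def)
  have AE: "A \<subseteq> E" using A F by (auto intro: lspan_base)
  \<comment> \<open>\<open>E\<close> contains \<open>F\<close> because it is an
    \<open>F\<close>-span containing \<open>1\<close>.\<close>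
  have FE: "F \<subseteq> E"
  proof
    fix c assume "c \<in> F"
    hence "c * 1 \<in> lspan F A" using F by (intro lspan_scale) (auto simp: A(3) subfieldD[OF E])
    thus "c \<in> E" using A(3) by simp
  qed
  let ?g = "\<lambda>(a, b). a * b" and ?I = "A \<times> B"
  have ind: "inj_on ?g ?I \<and> lin_indep F (?g ` ?I)"
  proof (rule lin_indep_image[OF F])
    fix c assume c: "\<And>i. i \<in> ?I \<Longrightarrow> c i \<in> F" and 0: "(\<Sum>i\<in>?I. c i * ?g i) = 0"
    have "(\<Sum>i\<in>?I. c i * ?g i) = (\<Sum>a\<in>A. \<Sum>b\<in>B. c (a, b) * (a * b))"
      unfolding sum.cartesian_product by (rule sum.cong) auto
    also have "\<dots> = (\<Sum>b\<in>B. (\<Sum>a\<in>A. c (a, b) * a) * b)"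
      by (subst sum.swap) (simp add: sum_distrib_right mult.assoc)
    finally have 1: "(\<Sum>b\<in>B. (\<Sum>a\<in>A. c (a, b) * a) * b) = 0" using 0 by simp
    have 2: "(\<Sum>a\<in>A. c (a, b) * a) = 0" if "b \<in> B" for b
      using AE FE c that by (intro lin_indepD[OF B(2,1) _ 1]) (auto intro!: subfield_sum[OF E] subfieldD(4)[OF E])
    have "c (a, b) = 0" if "a \<in> A" "b \<in> B" for a b
      using c that by (intro lin_indepD[OF A(2,1) _ 2[OF that(2)]]) auto
    thus "\<forall>i\<in>?I. c i = 0" by auto
  qed (use A B in auto)
  have "lspan F (?g ` ?I) = V"
  proof
    have "lspan F (?g ` ?I) \<subseteq> lspan E (?g ` ?I)" by (rule lspan_mono[OF FE order_refl])
    also have "\<dots> \<subseteq> lspan E B" using AE by (intro lspan_trans[OF E]) (auto intro!: lspan_mult[OF E])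
    finally show "lspan F (?g ` ?I) \<subseteq> V" using B by simp
    show "V \<subseteq> lspan F (?g ` ?I)" unfolding B(3)[symmetric]
    proof (rule lspan_minimal)
      fix e b assume e: "e \<in> E" "b \<in> B"
      have "e \<in> lspan F A" using e A by simp
      thus "e * b \<in> lspan F (?g ` ?I)"
      proof induction
        case (lspan_step c a v)
        have "c * (a * b) + v * b \<in> lspan F (?g ` ?I)"
          using lspan_step e by (intro lspan.lspan_step) force+
        thus ?case by (simp add: distrib_right mult.assoc)
      qed (simp add: lspan_zero)
    qed (auto intro: lspan_zero lspan_add)
  qed
  hence b: "basis F V (?g ` ?I)" using ind A B by (simp add: basis_def)
  have "card (?g ` ?I) = fdim F E * fdim E V" using ind A B card_image[of ?g ?I] by (simp add: card_cartesian_product)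
  thus ?thesis using b basis_fdim[OF F b] unfolding fin_dim_def by auto
qed

lemma fin_dim_intermediate:
  assumes F: "subfield F" and E: "subfield E" and V: "subfield V" and sub: "F \<subseteq> E" "E \<subseteq> V" and fd: "fin_dim F V"
  shows "fin_dim F E" "fin_dim E V" "fdim F V = fdim F E * fdim E V"
proof -
  obtain B where B: "finite B" "lspan F B = V" using fd by (auto simp: fin_dim_def basis_def)
  have "B \<subseteq> V" using B F by (auto intro: lspan_base)
  hence "lspan E B = V" using B sub lspan_mono[of F E B B] lspan_in_subfield[OF V, of E B] by auto
  thus EV: "fin_dim E V" using fin_dim_lspan[OF E B(1)] by auto
  show FE: "fin_dim F E" using fin_dim_subspace[OF F lspan_self[OF E F sub(1)] fd sub(2)] by auto
  show "fdim F V = fdim F E * fdim E V" using fdim_tower[OF F E FE EV] by auto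
qed

lemma fdim_pos: "subfield F \<Longrightarrow> subfield E \<Longrightarrow> fin_dim F E \<Longrightarrow> fdim F E > 0"
proof -
  assume F: "subfield F" and E: "subfield E" and fd: "fin_dim F E"
  have "lin_indep F {1}" by (auto simp: lin_indep_def subset_singleton_iff)
  from lin_indep_card_le[OF F fd this] show ?thesis using E by (auto simp: subfieldD)
qed

lemma fdim_self: "subfield F \<Longrightarrow> fin_dim F F \<and> fdim F F = 1"
proof -
  assume F: "subfield F"
  have "lin_indep F {1}" by (auto simp: lin_indep_def subset_singleton_iff)
  moreover have "lspan F {1} = F"
    using F lspan_mult[OF F, of _ 1 "{1}"] lspan_in_subfield[OF F order_refl, of "{1}"] by (auto simp: subfieldD)
  ultimately have "basis F F {1}" by (simp add: basis_def)
  thus ?thesis using basis_fdim[OF F] unfolding fin_dim_def by force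
qed

text \<open>An \<open>F\<close>-basis of \<open>E\<close> spans the compositum over
  \<open>L\<close>, though it may become dependent there.\<close>

lemma fdim_compositum:
  assumes F: "subfield F" and L: "subfield L" and FL: "F \<subseteq> L" and fd: "fin_dim F E"
  shows "fin_dim L (lspan L E) \<and> fdim L (lspan L E) \<le> fdim F E"
proof -
  obtain B where B: "finite B" "lspan F B = E" "card B = fdim F E"
    using fin_dim_basis[OF F fd] by (auto simp: basis_def)
  have "lspan L E = lspan L B"
  proof
    show "lspan L E \<subseteq> lspan L B" using B FL lspan_mono[of F L B B] by (intro lspan_trans[OF L]) auto
    show "lspan L B \<subseteq> lspan L E" using B F by (intro lspan_mono) (auto intro: lspan_base)
  qed
  thus ?thesis using fin_dim_lspan[OF L B(1)] B by simp
qed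

lemma lspan_lspan:
  assumes "subfield L" "F \<subseteq> L" "subfield F"
  shows "lspan L (lspan F S) = lspan L S"
proof
  show "lspan L (lspan F S) \<subseteq> lspan L S"
    using lspan_mono[OF assms(2), of S S] by (intro lspan_trans[OF assms(1)]) auto
  show "lspan L S \<subseteq> lspan L (lspan F S)" using assms by (intro lspan_mono) (auto intro: lspan_base)
qed

section \<open>Frobenius powers\<close>

lemma pow_set_pow_set: "pow_set m (pow_set n S) = pow_set (n * m) S"
  by (simp add: pow_set_def image_image power_mult)

lemma pow_set_1 [simp]: "pow_set (Suc 0) S = S"
  by (auto simp: pow_set_def)

lemma pow_set_mono: "S \<subseteq> T \<Longrightarrow> pow_set n S \<subseteq> pow_set n T"
  by (auto simp: pow_set_def)

lemma pow_set_subset: "subfield E \<Longrightarrow> S \<subseteq> E \<Longrightarrow> pow_set n S \<subseteq> E"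
  by (auto simp: pow_set_def subfield_power)

text \<open>The dummy parameter \<open>ty\<close> fixes the field type, which \<open>p\<close> alone
  does not mention.\<close>

locale frobenius =
  fixes p :: nat and ty :: "'a::field itself"
  assumes prime_p: "prime p" and char_p: "of_nat p = (0 :: 'a)"
begin

lemma CHAR_eq_p: "CHAR('a) = p"
  using char_p prime_p of_nat_eq_0_iff_char_dvd[where 'a='a, of p]
  by (metis CHAR_not_1' One_nat_def prime_nat_iff)

lemma frob_add: "((x::'a) + y) ^ (p ^ n) = x ^ (p ^ n) + y ^ (p ^ n)"
  using freshmans_dream'[where 'a='a, of "p ^ n" n x y] prime_p CHAR_eq_p by simp

lemma frob_diff: "((x::'a) - y) ^ (p ^ n) = x ^ (p ^ n) - y ^ (p ^ n)"
  using frob_add[of "x - y" y n] by (simp add: eq_diff_eq)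

lemma frob_0: "(0::'a) ^ (p ^ n) = 0"
  using prime_p by (simp add: prime_gt_0_nat)

lemma frob_inj: "inj (\<lambda>x::'a. x ^ (p ^ n))"
proof (rule injI)
  fix x y :: 'a assume "x ^ (p ^ n) = y ^ (p ^ n)"
  hence "(x - y) ^ (p ^ n) = 0" by (simp add: frob_diff)
  thus "x = y" by simp
qed

lemma frob_sum: "(\<Sum>t\<in>T. f t :: 'a) ^ (p ^ n) = (\<Sum>t\<in>T. f t ^ (p ^ n))"
  by (induction T rule: infinite_finite_induct) (simp_all add: frob_add frob_0 del: power_eq_0_iff)

lemma frob_pow: "((x::'a) ^ (p ^ m)) ^ (p ^ n) = x ^ (p ^ (m + n))"
  by (simp add: power_add flip: power_mult)

lemma subfield_pow_set: "subfield F \<Longrightarrow> subfield (pow_set (p ^ n) F :: 'a set)"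
proof -
  assume F: "subfield F"
  have "x + y \<in> pow_set (p ^ n) F" if "x \<in> pow_set (p ^ n) F" "y \<in> pow_set (p ^ n) F" for x y
    using that F unfolding pow_set_def by (auto simp: frob_add[symmetric] subfieldD)
  moreover have "x * y \<in> pow_set (p ^ n) F" if "x \<in> pow_set (p ^ n) F" "y \<in> pow_set (p ^ n) F" for x y
    using that F unfolding pow_set_def by (auto simp: power_mult_distrib[symmetric] subfieldD)
  moreover have "- x \<in> pow_set (p ^ n) F" if x: "x \<in> pow_set (p ^ n) F" for x
  proof -
    obtain y where y: "y \<in> F" "x = y ^ (p ^ n)" using x by (auto simp: pow_set_def)
    have "- x = (- y) ^ (p ^ n)" using frob_diff[of 0 y n] y by (simp add: frob_0 del: power_eq_0_iff)
    thus ?thesis using y F by (auto simp: pow_set_def subfieldD)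
  qed
  moreover have "inverse x \<in> pow_set (p ^ n) F" if "x \<in> pow_set (p ^ n) F" for x
    using that F unfolding pow_set_def by (auto simp: power_inverse[symmetric] subfieldD)
  moreover have "0 \<in> pow_set (p ^ n) F" using F unfolding pow_set_def
    by (auto intro!: image_eqI[of _ _ 0] simp: frob_0 subfieldD simp del: power_eq_0_iff)
  moreover have "1 \<in> pow_set (p ^ n) F" using F unfolding pow_set_def
    by (auto intro!: image_eqI[of _ _ 1] simp: subfieldD)
  ultimately show ?thesis by (simp add: subfield_def)
qed

lemma pow_set_lspan: "pow_set (p ^ n) (lspan F S :: 'a set) = lspan (pow_set (p ^ n) F) (pow_set (p ^ n) S)"
proof
  show "pow_set (p ^ n) (lspan F S) \<subseteq> lspan (pow_set (p ^ n) F) (pow_set (p ^ n) S)"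
  proof
    fix y assume "y \<in> pow_set (p ^ n) (lspan F S)"
    then obtain x where x: "x \<in> lspan F S" "y = x ^ (p ^ n)" by (auto simp: pow_set_def)
    have "x ^ (p ^ n) \<in> lspan (pow_set (p ^ n) F) (pow_set (p ^ n) S)"
      using x(1) by induction
        (auto simp: frob_0 frob_add power_mult_distrib pow_set_def lspan_zero simp del: power_eq_0_iff intro!: lspan.lspan_step)
    thus "y \<in> lspan (pow_set (p ^ n) F) (pow_set (p ^ n) S)" using x by simp
  qed
  show "lspan (pow_set (p ^ n) F) (pow_set (p ^ n) S) \<subseteq> pow_set (p ^ n) (lspan F S)"
  proof
    fix x assume "x \<in> lspan (pow_set (p ^ n) F) (pow_set (p ^ n) S)"
    thus "x \<in> pow_set (p ^ n) (lspan F S)"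
    proof induction
      case lspan_zero
      show ?case unfolding pow_set_def by (rule image_eqI[of _ _ 0]) (simp_all add: frob_0 lspan.lspan_zero del: power_eq_0_iff)
    next
      case (lspan_step c s v)
      then obtain c' s' v' where "c = c' ^ (p ^ n)" "s = s' ^ (p ^ n)" "v = v' ^ (p ^ n)"
        and *: "c' \<in> F" "s' \<in> S" "v' \<in> lspan F S" by (auto simp: pow_set_def)
      hence "c * s + v = (c' * s' + v') ^ (p ^ n)" by (simp add: frob_add power_mult_distrib)
      thus ?case unfolding pow_set_def using * by (auto intro: lspan.lspan_step)
    qed
  qed
qed

text \<open>Coefficients and vectors are both \<open>p^n\<close>-th powers, so a relation among them
  is the \<open>p^n\<close>-th power of a relation over \<open>F\<close>, which must vanish.\<close>

lemma lin_indep_pow_set: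
  assumes "lin_indep F (S :: 'a set)"
  shows "lin_indep (pow_set (p ^ n) F) (pow_set (p ^ n) S)"
  unfolding lin_indep_def
proof (intro allI impI ballI)
  fix T c t assume T: "finite T" "T \<subseteq> pow_set (p ^ n) S" "\<forall>t\<in>T. c t \<in> pow_set (p ^ n) F" "(\<Sum>t\<in>T. c t * t) = 0" "t \<in> T"
  obtain T' where T': "T' \<subseteq> S" "T = (\<lambda>x. x ^ (p ^ n)) ` T'" using T(2) unfolding pow_set_def by (auto simp: subset_image_iff)
  have inj: "inj_on (\<lambda>x. x ^ (p ^ n)) T'" using frob_inj inj_on_subset by blast
  have "\<forall>t\<in>T. \<exists>d\<in>F. c t = d ^ (p ^ n)" using T(3) by (auto simp: pow_set_def)
  then obtain d where d: "\<forall>t\<in>T. d t \<in> F \<and> c t = d t ^ (p ^ n)" by metis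
  have "0 = (\<Sum>x\<in>T'. (d (x ^ (p ^ n)) * x) ^ (p ^ n))"
    using T(4) d unfolding T'(2) by (subst (asm) sum.reindex[OF inj]) (simp add: power_mult_distrib)
  also have "\<dots> = (\<Sum>x\<in>T'. d (x ^ (p ^ n)) * x) ^ (p ^ n)" by (rule frob_sum[symmetric])
  finally have 0: "(\<Sum>x\<in>T'. d (x ^ (p ^ n)) * x) = 0" by simp
  have fT': "finite T'" using T(1) T'(2) inj finite_imageD by blast
  have "d (x ^ (p ^ n)) = 0" if "x \<in> T'" for x
    using d T' fT' that by (intro lin_indepD[OF lin_indep_subset[OF assms T'(1)] _ _ 0]) auto
  thus "c t = 0" using T(5) d T'(2) by (auto simp: frob_0 simp del: power_eq_0_iff)
qed

lemma fdim_pow_set: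
  assumes F: "subfield F" and fd: "fin_dim F (V :: 'a set)"
  shows "fin_dim (pow_set (p ^ n) F) (pow_set (p ^ n) V) \<and> fdim (pow_set (p ^ n) F) (pow_set (p ^ n) V) = fdim F V"
proof -
  obtain B where B: "basis F V B" "card B = fdim F V" using fin_dim_basis[OF F fd] by auto
  have b: "basis (pow_set (p ^ n) F) (pow_set (p ^ n) V) (pow_set (p ^ n) B)"
    using B(1) lin_indep_pow_set[of F B n] unfolding basis_def by (auto simp: pow_set_lspan[symmetric]) (simp add: pow_set_def)
  have "card (pow_set (p ^ n) B) = card B" unfolding pow_set_def
    using frob_inj inj_on_subset by (intro card_image) blast
  thus ?thesis using b basis_fdim[OF subfield_pow_set[OF F] b] B(2) unfolding fin_dim_def by auto
qed

end


section \<open>Purely inseparable extensions\<close>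

lemma adjoin_minimal: "subfield E \<Longrightarrow> F \<subseteq> E \<Longrightarrow> S \<subseteq> E \<Longrightarrow> adjoin F S \<subseteq> E"
  by (auto simp: adjoin_def)

lemma adjoin_superset: "F \<subseteq> adjoin F S" "S \<subseteq> adjoin F S"
  by (auto simp: adjoin_def)

lemma subfield_adjoin: "subfield (adjoin F S)"
  unfolding subfield_def adjoin_def by (auto intro: subfieldD)

lemma adjoin_mono: "F \<subseteq> F' \<Longrightarrow> S \<subseteq> S' \<Longrightarrow> adjoin F S \<subseteq> adjoin F' S'"
  unfolding adjoin_def by (rule Inter_anti_mono) auto

lemma adjoin_adjoin: "adjoin (adjoin F S) T = adjoin F (S \<union> T)"
proof
  show "adjoin (adjoin F S) T \<subseteq> adjoin F (S \<union> T)"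
    using adjoin_superset[where F=F and S="S \<union> T"] by (intro adjoin_minimal subfield_adjoin adjoin_mono) auto
  show "adjoin F (S \<union> T) \<subseteq> adjoin (adjoin F S) T"
    using adjoin_superset[where F=F and S=S] adjoin_superset[where F="adjoin F S" and S=T]
    by (intro adjoin_minimal subfield_adjoin) auto
qed

lemma adjoin_self: "subfield E \<Longrightarrow> F \<subseteq> E \<Longrightarrow> S \<subseteq> E \<Longrightarrow> E \<subseteq> adjoin F S \<Longrightarrow> adjoin F S = E"
  using adjoin_minimal by blast

lemma adjoin_empty: "subfield F \<Longrightarrow> adjoin F {} = F"
  by (rule adjoin_self) (auto simp: adjoin_def)

lemma lspan_mult_closed:
  assumes F: "subfield F" and S: "\<And>x y. x \<in> S \<Longrightarrow> y \<in> S \<Longrightarrow> x * y \<in> S"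
    and "x \<in> lspan F S" "y \<in> lspan F S"
  shows "x * y \<in> lspan F S"
  using assms(3)
proof induction
  case (lspan_step c s v)
  have "s * y \<in> lspan F S" using assms(4)
  proof induction
    case (lspan_step d t w)
    have "d * (s * t) + s * w \<in> lspan F S" using lspan_step S \<open>s \<in> S\<close> by (intro lspan.lspan_step) auto
    thus ?case by (simp add: algebra_simps)
  qed (simp add: lspan_zero)
  hence "c * (s * y) + v * y \<in> lspan F S" using lspan_step F by (blast intro: lspan_add lspan_scale)
  thus ?case by (simp add: algebra_simps)
qed (simp add: lspan_zero)

text \<open>The field \<open>k(E^(p^j))\<close>: for a subfield \<open>E\<close> of a purely inseparable extension the linear span is
  already closed under inverses.\<close>

definition kpow :: "nat \<Rightarrow> 'a::field set \<Rightarrow> nat \<Rightarrow> 'a set \<Rightarrow> 'a set" where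
  "kpow p k j E = lspan k (pow_set (p ^ j) E)"

lemma kpow_mono: "k \<subseteq> k' \<Longrightarrow> E \<subseteq> E' \<Longrightarrow> kpow p k j E \<subseteq> kpow p k' j E'"
  unfolding kpow_def by (intro lspan_mono pow_set_mono)

locale pins = frobenius p "TYPE('a::field)" for p :: nat +
  fixes k K :: "'a::field set"
  assumes insep: "purely_insep p k K"
begin

lemma sf_k: "subfield k" and sf_K: "subfield K" and k_sub: "k \<subseteq> K"
  using insep by (auto simp: purely_insep_def field_ext_def)

lemma insep_ex: "x \<in> K \<Longrightarrow> \<exists>n. x ^ (p ^ n) \<in> k"
  using insep by (auto simp: purely_insep_def)

lemma pins_base: "subfield L \<Longrightarrow> k \<subseteq> L \<Longrightarrow> L \<subseteq> K \<Longrightarrow> pins p L K"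
  using sf_K insep_ex unfolding pins_def pins_axioms_def purely_insep_def field_ext_def
  by (blast intro: frobenius_axioms)

lemma power_p_mono: "x ^ (p ^ m) \<in> k \<Longrightarrow> m \<le> n \<Longrightarrow> x ^ (p ^ n) \<in> k"
  using frob_pow[of x m "n - m"] subfield_power[OF sf_k, of "x ^ (p ^ m)" "p ^ (n - m)"] by simp

text \<open>Some \<open>x^(p^n)\<close> lies in \<open>k\<close>, so \<open>inverse x\<close> is
  \<open>x^(p^n - 1)\<close> divided by an element of \<open>k\<close>; negatives come from
  \<open>-1\<close> in \<open>k\<close>.\<close>

lemma subring_subfield:
  assumes "k \<subseteq> R" "R \<subseteq> K" "\<And>x y. x \<in> R \<Longrightarrow> y \<in> R \<Longrightarrow> x + y \<in> R" "\<And>x y. x \<in> R \<Longrightarrow> y \<in> R \<Longrightarrow> x * y \<in> R"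
  shows "subfield R"
proof -
  have "- x \<in> R" if "x \<in> R" for x
    using assms(4)[of "-1" x] assms(1) that subfieldD(5)[OF sf_k subfieldD(2)[OF sf_k]] by auto
  moreover have "inverse x \<in> R" if x: "x \<in> R" for x
  proof (cases "x = 0")
    case False
    obtain n where n: "x ^ (p ^ n) \<in> k" using insep_ex x assms(2) by blast
    have pow: "x ^ m \<in> R" for m
      using assms(1,4) x subfieldD[OF sf_k] by (induction m) auto
    have "inverse (x ^ (p ^ n)) \<in> R" using n assms(1) subfieldD[OF sf_k] by auto
    hence "inverse (x ^ (p ^ n)) * x ^ (p ^ n - 1) \<in> R" using assms(4) pow by auto
    moreover have "x ^ (p ^ n) = x * x ^ (p ^ n - 1)"
      using prime_p by (simp add: power_eq_if[of x "p ^ n"] prime_gt_0_nat)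
    ultimately show ?thesis using False by (simp add: field_simps)
  qed (use x in simp)
  ultimately show ?thesis using assms subfieldD[OF sf_k] unfolding subfield_def by (simp add: subset_iff)
qed

lemma subset_lspan: "1 \<in> S \<Longrightarrow> k \<subseteq> lspan k S"
  using lspan_mult[OF sf_k, of _ 1 S] by auto

lemma subfield_lspan:
  assumes "S \<subseteq> K" "1 \<in> S" "\<And>x y. x \<in> S \<Longrightarrow> y \<in> S \<Longrightarrow> x * y \<in> S"
  shows "subfield (lspan k S)"
proof (rule subring_subfield)
  show "lspan k S \<subseteq> K" using lspan_in_subfield[OF sf_K k_sub assms(1)] .
qed (use assms sf_k in \<open>auto intro: subset_lspan[THEN subsetD] lspan_add lspan_mult_closed\<close>)

text \<open>The span of a multiplicatively closed set is already a field here, so adjoined fields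
  can be handled as vector spaces.\<close>

lemma adjoin_eq_lspan:
  assumes "S \<subseteq> K" "1 \<in> S" "\<And>x y. x \<in> S \<Longrightarrow> y \<in> S \<Longrightarrow> x * y \<in> S"
  shows "adjoin k S = lspan k S"
proof (rule adjoin_self)
  show "lspan k S \<subseteq> adjoin k S" by (intro lspan_in_subfield subfield_adjoin adjoin_superset)
qed (use assms sf_k in \<open>auto intro: subset_lspan[THEN subsetD] subfield_lspan lspan_base\<close>)

lemma adjoin_subfield: "subfield E \<Longrightarrow> E \<subseteq> K \<Longrightarrow> adjoin k E = lspan k E"
  by (rule adjoin_eq_lspan) (auto simp: subfieldD)

lemma adjoin_sub: "S \<subseteq> K \<Longrightarrow> adjoin k S \<subseteq> K"
  by (rule adjoin_minimal[OF sf_K k_sub])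

lemma pow_set_sub: "E \<subseteq> K \<Longrightarrow> pow_set n E \<subseteq> K"
  by (rule pow_set_subset[OF sf_K])

lemma kpow_eq_adjoin: "subfield E \<Longrightarrow> E \<subseteq> K \<Longrightarrow> kpow p k j E = adjoin k (pow_set (p ^ j) E)"
  unfolding kpow_def by (intro adjoin_subfield[symmetric] subfield_pow_set pow_set_sub)

lemma kpow_subfield: "subfield E \<Longrightarrow> E \<subseteq> K \<Longrightarrow> subfield (kpow p k j E)"
  using kpow_eq_adjoin subfield_adjoin by metis

lemma kpow_superset: "subfield E \<Longrightarrow> k \<subseteq> kpow p k j E" "pow_set (p ^ j) E \<subseteq> kpow p k j E"
proof -
  show "k \<subseteq> kpow p k j E" if "subfield E"
    unfolding kpow_def using subfieldD(2)[OF subfield_pow_set[OF that]] by (rule subset_lspan)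
qed (auto simp: kpow_def lspan_base sf_k)

lemma kpow_subset: "subfield E \<Longrightarrow> k \<subseteq> E \<Longrightarrow> kpow p k j E \<subseteq> E"
  unfolding kpow_def by (intro lspan_in_subfield pow_set_subset) auto

lemma kpow_sub_K: "E \<subseteq> K \<Longrightarrow> kpow p k j E \<subseteq> K"
  unfolding kpow_def by (intro lspan_in_subfield sf_K k_sub pow_set_sub)

lemma kpow_0: "subfield E \<Longrightarrow> k \<subseteq> E \<Longrightarrow> kpow p k 0 E = E"
  by (simp add: kpow_def lspan_self sf_k)

text \<open>The inner coefficients, raised to \<open>k^(p^i)\<close>, lie in \<open>k\<close> and
  are absorbed by the outer span.\<close>

lemma kpow_kpow: "kpow p k i (kpow p k j E) = kpow p k (i + j) E"
proof -
  have "kpow p k i (kpow p k j E) = lspan k (lspan (pow_set (p ^ i) k) (pow_set (p ^ i) (pow_set (p ^ j) E)))"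
    by (simp add: kpow_def pow_set_lspan)
  also have "\<dots> = lspan k (pow_set (p ^ i) (pow_set (p ^ j) E))"
    by (intro lspan_lspan sf_k pow_set_subset subfield_pow_set order_refl)
  also have "\<dots> = kpow p k (i + j) E" by (simp add: kpow_def pow_set_pow_set power_add mult.commute)
  finally show ?thesis .
qed

lemma kpow_antimono:
  assumes "subfield E" "E \<subseteq> K" "i \<le> j" shows "kpow p k j E \<subseteq> kpow p k i E"
  using kpow_subset[OF kpow_subfield[OF assms(1,2), of i] kpow_superset(1)[OF assms(1)], of "j - i"]
  by (simp add: kpow_kpow assms)

lemma common_exponent:
  assumes "finite T" "T \<subseteq> K" shows "\<exists>n. \<forall>x\<in>T. x ^ (p ^ n) \<in> k"
  using assms
proof (induction T)
  case (insert x T)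
  then obtain n m where nm: "\<forall>x\<in>T. x ^ (p ^ n) \<in> k" "x ^ (p ^ m) \<in> k" using insep_ex[of x] by auto
  show ?case
  proof (intro exI ballI)
    fix y assume "y \<in> insert x T"
    thus "y ^ (p ^ (max m n)) \<in> k"
      using nm power_p_mono[of y n "max m n"] power_p_mono[of y m "max m n"] by auto
  qed
qed simp

lemma pow_set_lspan_subset:
  assumes "\<forall>x\<in>S. x ^ (p ^ n) \<in> k" shows "pow_set (p ^ n) (lspan k S) \<subseteq> k"
proof -
  have "pow_set (p ^ n) S \<subseteq> k" using assms by (auto simp: pow_set_def)
  thus ?thesis unfolding pow_set_lspan by (intro lspan_in_subfield sf_k pow_set_subset[OF sf_k order_refl])
qed

lemma fin_dim_exponent:
  assumes "fin_dim k E" "E \<subseteq> K" shows "\<exists>n. pow_set (p ^ n) E \<subseteq> k"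
proof -
  obtain B where B: "finite B" "lspan k B = E" using assms by (auto simp: fin_dim_def basis_def)
  have "B \<subseteq> K" using B assms sf_k by (auto intro: lspan_base)
  thus ?thesis using common_exponent[OF B(1)] pow_set_lspan_subset[of B] B(2) by blast
qed

text \<open>Division with remainder by \<open>q\<close> reduces every power of \<open>x\<close> to a
  \<open>k\<close>-multiple of a power below \<open>q\<close>.\<close>

lemma adjoin_simple:
  assumes x: "x \<in> K" "x ^ q \<in> k" "q > 0"
  shows "fin_dim k (adjoin k {x}) \<and> fdim k (adjoin k {x}) \<le> q"
proof -
  let ?S = "range (\<lambda>i::nat. x ^ i)" and ?B = "(\<lambda>i. x ^ i) ` {..<q}"
  have "adjoin k {x} = adjoin k ?S"
  proof
    have "{x} \<subseteq> ?S" by (auto intro: range_eqI[of _ _ 1])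
    thus "adjoin k {x} \<subseteq> adjoin k ?S" by (intro adjoin_mono) auto
    show "adjoin k ?S \<subseteq> adjoin k {x}" using adjoin_superset[where F=k and S="{x}"]
      by (intro adjoin_minimal subfield_adjoin) (auto intro: subfield_power subfield_adjoin)
  qed
  also have "\<dots> = lspan k ?S"
    using x subfield_power[OF sf_K] by (intro adjoin_eq_lspan) (auto simp flip: power_add intro: range_eqI[of _ _ 0])
  also have "\<dots> = lspan k ?B"
  proof
    show "lspan k ?S \<subseteq> lspan k ?B"
    proof (rule lspan_trans[OF sf_k], rule subsetI)
      fix y assume "y \<in> ?S"
      then obtain i where "y = x ^ i" by auto
      also have "\<dots> = (x ^ q) ^ (i div q) * x ^ (i mod q)" by (simp flip: power_mult power_add)
      also have "\<dots> \<in> lspan k ?B" using x by (intro lspan_mult[OF sf_k] subfield_power[OF sf_k, of "x ^ q"]) auto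
      finally show "y \<in> lspan k ?B" .
    qed
    show "lspan k ?B \<subseteq> lspan k ?S" by (rule lspan_mono) auto
  qed
  finally have eq: "adjoin k {x} = lspan k ?B" .
  show ?thesis unfolding eq using fin_dim_lspan[OF sf_k, of ?B] card_image_le[of "{..<q}" "\<lambda>i. x ^ i"] by simp
qed

lemma adjoin_finite:
  assumes "finite T" "T \<subseteq> K" "\<forall>x\<in>T. x ^ q \<in> k" "q > 0"
  shows "fin_dim k (adjoin k T) \<and> fdim k (adjoin k T) \<le> q ^ card T"
  using assms(1-3)
proof (induction T)
  case empty thus ?case using fdim_self[OF sf_k] by (simp add: adjoin_empty sf_k)
next
  case (insert x T)
  let ?E = "adjoin k T"
  have IH: "fin_dim k ?E" "fdim k ?E \<le> q ^ card T" using insert by auto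
  interpret E: pins p ?E K
    using insert by (intro pins_base subfield_adjoin adjoin_sub adjoin_superset) auto
  have s: "fin_dim ?E (adjoin ?E {x})" "fdim ?E (adjoin ?E {x}) \<le> q"
    using E.adjoin_simple[of x q] insert assms(4) adjoin_superset[where F=k and S=T] by auto
  have eq: "adjoin ?E {x} = adjoin k (insert x T)" by (simp add: adjoin_adjoin)
  have "fdim k ?E * fdim ?E (adjoin ?E {x}) \<le> q ^ card T * q" using IH s by (intro mult_mono) auto
  thus ?case using fdim_tower[OF sf_k subfield_adjoin IH(1) s(1)] insert unfolding eq by (simp add: mult.commute)
qed

lemma adjoin_fin_dim:
  assumes "finite T" "T \<subseteq> K" shows "fin_dim k (adjoin k T)"
proof -
  obtain n where "\<forall>x\<in>T. x ^ (p ^ n) \<in> k" using common_exponent[OF assms] by auto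
  thus ?thesis using adjoin_finite[OF assms, of "p ^ n"] prime_p by (auto simp: prime_gt_0_nat)
qed

lemma fin_dim_kpow_step:
  assumes E: "subfield E" "k \<subseteq> E" "E \<subseteq> K" "fin_dim k E"
  shows "fin_dim (kpow p k j E) E" "fin_dim k (kpow p k j E)"
  using fin_dim_intermediate[OF sf_k kpow_subfield E(1) kpow_superset(1) kpow_subset E(4)] E by auto

text \<open>Compare the two towers \<open>k(E\<^sup>p) \<subseteq> E \<subseteq> E'\<close> and \<open>k(E\<^sup>p) \<subseteq> k(E'\<^sup>p) \<subseteq> E'\<close>; Frobenius bounds the lower
  step of the second by \<open>[E' : E]\<close>.\<close>

lemma fdim_kpow_mono:
  assumes E: "subfield E" "k \<subseteq> E" and E': "subfield E'" "E \<subseteq> E'" "E' \<subseteq> K" "fin_dim k E'"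
  shows "fdim (kpow p k 1 E) E \<le> fdim (kpow p k 1 E') E'"
proof -
  let ?D = "kpow p k 1 E" and ?D' = "kpow p k 1 E'"
  note kE' = subset_trans[OF E(2) E'(2)] note EK = subset_trans[OF E'(2,3)]
  have fE: "fin_dim k E" "fin_dim E E'" using fin_dim_intermediate[OF sf_k E(1) E'(1) E(2) E'(2,4)] by auto
  have D: "subfield ?D" "k \<subseteq> ?D" "?D \<subseteq> E" using kpow_subfield kpow_superset kpow_subset E EK by auto
  have D': "subfield ?D'" "?D' \<subseteq> E'" using kpow_subfield kpow_subset E' kE' by auto
  have DD': "?D \<subseteq> ?D'" using E' by (intro kpow_mono) auto
  have fD: "fin_dim ?D E'" using fin_dim_intermediate[OF sf_k D(1) E'(1) D(2) _ E'(4)] D E' by auto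
  have "fdim ?D E' = fdim ?D E * fdim E E'"
    using fin_dim_intermediate(3)[OF D(1) E(1) E'(1) D(3) E'(2) fD] .
  moreover have "fdim ?D E' = fdim ?D ?D' * fdim ?D' E'"
    using fin_dim_intermediate(3)[OF D(1) D'(1) E'(1) DD' D'(2) fD] .
  moreover have "fdim ?D ?D' \<le> fdim E E'"
  proof -
    have fr: "fin_dim (pow_set (p ^ 1) E) (pow_set (p ^ 1) E')" "fdim (pow_set (p ^ 1) E) (pow_set (p ^ 1) E') = fdim E E'"
      using fdim_pow_set[OF E(1) fE(2), of 1] by auto
    \<comment> \<open>Scalars from \<open>k\<close> already lie in \<open>?D\<close>, so
      \<open>E'^p\<close> generates \<open>?D'\<close> over \<open>?D\<close>; the Frobenius image
      of \<open>E'/E\<close> then bounds this degree.\<close>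
    have "lspan ?D (pow_set (p ^ 1) E') = ?D'"
    proof
      show "lspan ?D (pow_set (p ^ 1) E') \<subseteq> ?D'" by (intro lspan_in_subfield DD' kpow_superset(2) D'(1))
      show "?D' \<subseteq> lspan ?D (pow_set (p ^ 1) E')" unfolding kpow_def[of p k 1 E'] by (intro lspan_mono D) auto
    qed
    thus ?thesis
      using fdim_compositum[OF subfield_pow_set[OF E(1), of 1] D(1) kpow_superset(2) fr(1)] fr(2) by simp
  qed
  ultimately have "fdim ?D E * fdim E E' \<le> fdim ?D' E' * fdim E E'" by (metis mult.commute mult_le_mono1)
  thus ?thesis using fdim_pos[OF E(1) E'(1) fE(2)] by simp
qed

text \<open>Every generator has its \<open>p\<close>-th power in \<open>k(E^p)\<close>, so each
  contributes at most a factor \<open>p\<close>.\<close>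

lemma fdim_kpow_adjoin:
  assumes T: "finite T" "T \<subseteq> K"
  shows "fdim (kpow p k 1 (adjoin k T)) (adjoin k T) \<le> p ^ card T"
proof -
  let ?E = "adjoin k T" let ?D = "kpow p k 1 ?E"
  note E = subfield_adjoin[of k T] adjoin_superset[where F=k and S=T] adjoin_sub[OF T(2)]
  have D: "subfield ?D" "k \<subseteq> ?D" "?D \<subseteq> ?E" using kpow_subfield kpow_superset kpow_subset E by auto
  interpret D: pins p ?D K using D E by (intro pins_base) auto
  have "\<forall>x\<in>T. x ^ p \<in> ?D" using kpow_superset(2)[of 1 ?E] E by (auto simp: pow_set_def)
  hence "fdim ?D (adjoin ?D T) \<le> p ^ card T" using D.adjoin_finite[OF T, of p] prime_p by (auto simp: prime_gt_0_nat)
  moreover have "adjoin ?D T = ?E" using D E by (intro adjoin_self adjoin_mono) auto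
  ultimately show ?thesis by simp
qed

end

text \<open>Unlike \<open>q_finite\<close>, this form of the finiteness hypothesis passes to larger base fields immediately.\<close>

locale bounded_gen = pins p k K for p :: nat and k K :: "'a::field set" +
  fixes B :: nat
  assumes bounded: "finite S \<Longrightarrow> S \<subseteq> K \<Longrightarrow> \<exists>T\<subseteq>K. finite T \<and> card T \<le> B \<and> S \<subseteq> adjoin k T"
begin

lemma bounded_gen_base: "subfield L \<Longrightarrow> k \<subseteq> L \<Longrightarrow> L \<subseteq> K \<Longrightarrow> bounded_gen p L K B"
  using bounded adjoin_mono[of k L] unfolding bounded_gen_def bounded_gen_axioms_def
  by (meson order_refl pins_base subset_trans)

text \<open>\<open>N\<close> may be infinite over \<open>k\<close>, so finite independent sets
  \<open>S\<close> are bounded instead. Such an \<open>S\<close> stays independent over the smaller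
  field \<open>k(k(S)^p)\<close>, and \<open>fdim_kpow_mono\<close> compares \<open>k(S)\<close>
  with a field \<open>k(T)\<close> on at most \<open>B\<close> generators.\<close>

lemma fdim_kpow_le:
  assumes N: "subfield N" "k \<subseteq> N" "N \<subseteq> K"
  shows "fin_dim (kpow p k 1 N) N \<and> fdim (kpow p k 1 N) N \<le> p ^ B"
proof (rule fin_dim_bounded)
  show sf: "subfield (kpow p k 1 N)" using kpow_subfield N by auto
  show "lspan (kpow p k 1 N) N = N" using N sf kpow_subset by (intro lspan_self) auto
  fix S assume S: "finite S" "S \<subseteq> N" "lin_indep (kpow p k 1 N) S"
  let ?E = "adjoin k S"
  have SK: "S \<subseteq> K" using S N by auto
  obtain T where T: "T \<subseteq> K" "finite T" "card T \<le> B" "S \<subseteq> adjoin k T" using bounded[OF S(1) SK] by auto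
  note E = subfield_adjoin[of k S] adjoin_superset[where F=k and S=S] adjoin_sub[OF SK]
  have "kpow p k 1 ?E \<subseteq> kpow p k 1 N" using N S by (intro kpow_mono adjoin_minimal) auto
  hence "lin_indep (kpow p k 1 ?E) S" using S lin_indep_antimono by blast
  hence "card S \<le> fdim (kpow p k 1 ?E) ?E"
    using lin_indep_card_le[OF kpow_subfield[OF E(1,4)] fin_dim_kpow_step(1)] E adjoin_fin_dim[OF S(1) SK] by auto
  also have "\<dots> \<le> fdim (kpow p k 1 (adjoin k T)) (adjoin k T)"
    using T(4) by (intro fdim_kpow_mono adjoin_minimal subfield_adjoin adjoin_fin_dim[OF T(2,1)] adjoin_sub[OF T(1)] adjoin_superset)
  also have "\<dots> \<le> p ^ card T" by (rule fdim_kpow_adjoin[OF T(2,1)])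
  also have "\<dots> \<le> p ^ B" using T prime_p by (intro power_increasing) (auto dest: prime_gt_0_nat)
  finally show "card S \<le> p ^ B" .
qed

text \<open>Each step from \<open>k(N^(p^(j+1)))\<close> up to \<open>k(N^(p^j))\<close> is finite
  by \<open>fdim_kpow_le\<close> applied to the larger field.\<close>

lemma fin_dim_kpow:
  assumes N: "subfield N" "k \<subseteq> N" "N \<subseteq> K"
  shows "fin_dim (kpow p k j N) N"
proof (induction j)
  case 0 thus ?case using N fdim_self[of N] by (simp add: kpow_0)
next
  case (Suc j)
  have "fin_dim (kpow p k 1 (kpow p k j N)) (kpow p k j N)"
    using fdim_kpow_le[OF kpow_subfield kpow_superset(1) kpow_sub_K] N by auto
  thus ?case using fdim_tower[OF _ _ _ Suc] kpow_subfield N by (simp add: kpow_kpow)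
qed

end


section \<open>Modularity of ascending chains\<close>

lemma lin_indep_spanning_card:
  assumes F: "subfield F" and Y: "finite Y" "fdim F (lspan F Y) = card Y"
  shows "lin_indep F Y"
proof -
  have "lin_indep F {}" by (simp add: lin_indep_def)
  from basis_extend[OF F _ this Y(1)] obtain B where B: "B \<subseteq> Y" "basis F (lspan F Y) B" by auto
  hence "card B = card Y" using basis_fdim[OF F B(2)] Y(2) by simp
  hence "B = Y" using card_subset_eq[OF Y(1) B(1)] by simp
  thus ?thesis using B by (simp add: basis_def)
qed

text \<open>A term of least degree over \<open>F\<close> contains every later term, which then has
  the same degree and is equal to it.\<close>

lemma decreasing_stabilizes:
  fixes D :: "nat \<Rightarrow> 'a::field set"
  assumes F: "subfield F" and D: "\<And>j. subfield (D j)" "\<And>j. F \<subseteq> D j" "\<And>i j. i \<le> j \<Longrightarrow> D j \<subseteq> D i"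
    and fd: "fin_dim F (D 0)"
  shows "\<exists>J. \<forall>j\<ge>J. D j = D J"
proof -
  have fin: "fin_dim F (D j)" for j
    using fin_dim_intermediate(1)[OF F D(1) D(1) D(2) D(3)[OF le0] fd] .
  obtain J where J: "\<And>j. fdim F (D J) \<le> fdim F (D j)"
    using ex_has_least_nat[of "\<lambda>_. True" 0 "\<lambda>j. fdim F (D j)"] by auto
  have "D j = D J" if "j \<ge> J" for j
  proof (rule fdim_eq_imp_eq[OF F fin fin D(3)[OF that]])
    show "fdim F (D j) = fdim F (D J)"
      using J[of j] fin_dim_subspace[OF F lspan_self[OF D(1) F D(2)] fin D(3)[OF that]] by simp
  qed
  thus ?thesis by auto
qed

lemma bounded_mono_constant:
  fixes d :: "nat \<Rightarrow> nat"
  assumes mono: "\<And>n. d n \<le> d (Suc n)" and bd: "\<And>n. d n \<le> b"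
  shows "\<exists>n0. \<forall>n\<ge>n0. d n = d n0"
proof -
  obtain n0 where n0: "d n0 = Greatest (\<lambda>x. \<exists>n. d n = x)"
    using GreatestI_nat[of "\<lambda>x. \<exists>n. d n = x" "d 0" b] bd by auto
  have "d n \<le> d n0" for n
    unfolding n0 by (rule Greatest_le_nat[of "\<lambda>x. \<exists>n. d n = x" _ b]) (use bd in auto)
  moreover have "d n0 \<le> d n" if "n \<ge> n0" for n
    using that mono by (rule lift_Suc_mono_le[of d, rotated])
  ultimately show ?thesis by (intro exI[of _ n0]) (auto intro: le_antisym)
qed

lemma subfield_Union_chain:
  assumes sf: "\<And>n::nat. subfield (D n)" and inc: "\<And>n. D n \<subseteq> D (Suc n)"
  shows "subfield (\<Union>n. D n)"
proof -
  have mono: "m \<le> n \<Longrightarrow> D m \<subseteq> D n" for m n using lift_Suc_mono_le[of D] inc by blast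
  have both: "\<exists>n. x \<in> D n \<and> y \<in> D n" if "x \<in> D i" "y \<in> D j" for x y i j
    using that mono[of i "max i j"] mono[of j "max i j"] by (intro exI[of _ "max i j"]) auto
  have "x + y \<in> (\<Union>n. D n) \<and> x * y \<in> (\<Union>n. D n)" if xy: "x \<in> (\<Union>n. D n)" "y \<in> (\<Union>n. D n)" for x y
  proof -
    obtain i j where "x \<in> D i" "y \<in> D j" using xy by auto
    then obtain n where "x \<in> D n" "y \<in> D n" using both by blast
    thus ?thesis using subfieldD(3,4)[OF sf[of n]] by (simp add: UN_iff) blast
  qed
  moreover have "- x \<in> (\<Union>n. D n) \<and> inverse x \<in> (\<Union>n. D n)" if x: "x \<in> (\<Union>n. D n)" for x
  proof -
    obtain n where "x \<in> D n" using x by auto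
    thus ?thesis using subfieldD(5,6)[OF sf[of n]] by auto
  qed
  moreover have "0 \<in> (\<Union>n. D n)" "1 \<in> (\<Union>n. D n)" using subfieldD(1,2)[OF sf[of 0]] by auto
  ultimately show ?thesis by (simp add: subfield_def)
qed

lemma finite_subset_Union_chain:
  assumes inc: "\<And>n::nat. D n \<subseteq> D (Suc n)" and "finite T" "T \<subseteq> (\<Union>n. D n)"
  shows "\<exists>n. T \<subseteq> D n"
  using assms(2,3)
proof (induction T)
  case (insert x T)
  have mono: "m \<le> n \<Longrightarrow> D m \<subseteq> D n" for m n using lift_Suc_mono_le[of D] inc by blast
  obtain i j where "T \<subseteq> D i" "x \<in> D j" using insert by auto
  thus ?case using mono[of i "max i j"] mono[of j "max i j"] by (intro exI[of _ "max i j"]) auto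
qed simp

context frobenius
begin

text \<open>The elements whose \<open>p^n\<close>-th power lies in \<open>E\<close> form a subfield,
  so it suffices to check generators.\<close>

lemma pow_set_adjoin_subset:
  assumes E: "subfield (E :: 'a set)" and "pow_set (p ^ n) F \<subseteq> E" "pow_set (p ^ n) S \<subseteq> E"
  shows "pow_set (p ^ n) (adjoin F S) \<subseteq> E"
proof -
  let ?R = "{x. x ^ (p ^ n) \<in> E}"
  have neg: "(- x) ^ (p ^ n) = - (x ^ (p ^ n))" for x :: 'a
    using frob_diff[of 0 x n] by (simp add: frob_0 del: power_eq_0_iff)
  have "subfield ?R" using subfieldD[OF E]
    by (simp add: subfield_def frob_0 frob_add neg power_mult_distrib power_inverse del: power_eq_0_iff)
  moreover have "F \<subseteq> ?R" "S \<subseteq> ?R" using assms by (auto simp: pow_set_def)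
  ultimately have "adjoin F S \<subseteq> ?R" by (intro adjoin_minimal)
  thus ?thesis by (auto simp: pow_set_def)
qed

end

context pins
begin

section \<open>Chains in which the \<open>p\<close>-th powers of each term generate the preceding
  one over \<open>k\<close>\<close>

context
  fixes D :: "nat \<Rightarrow> 'a set"
  assumes D_0: "D 0 = k" and sf_D: "\<And>n. subfield (D n)" and D_sub: "\<And>n. D n \<subseteq> K"
    and D_inc: "\<And>n. D n \<subseteq> D (Suc n)" and D_pow: "\<And>n. kpow p k 1 (D (Suc n)) = D n"
begin

lemma chain_mono: "m \<le> n \<Longrightarrow> D m \<subseteq> D n"
  using lift_Suc_mono_le[of D] D_inc by blast

lemma chain_kpow: "kpow p k m (D (m + n)) = D n"
proof (induction m)
  case 0 thus ?case using kpow_0[OF sf_D] chain_mono[of 0 n] D_0 by simp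
next
  case (Suc m)
  have "kpow p k (Suc m) (D (Suc m + n)) = kpow p k m (kpow p k 1 (D (Suc (m + n))))"
    by (simp add: kpow_kpow)
  thus ?case using Suc D_pow by simp
qed

lemma chain_fdim_power:
  assumes "\<And>n. fin_dim (D n) (D (Suc n))" "\<And>n. fdim (D n) (D (Suc n)) = d"
  shows "fin_dim (D m) (D (m + n)) \<and> fdim (D m) (D (m + n)) = d ^ n"
proof (induction n)
  case 0 thus ?case using fdim_self[OF sf_D] by simp
next
  case (Suc n)
  thus ?case using fdim_tower[OF sf_D sf_D, of m "m + n" "D (Suc (m + n))"] assms by (simp add: mult.commute)
qed

text \<open>A basis of \<open>D\<^sub>m\<^sub>+\<^sub>n\<^sup>q\<close> over \<open>D\<^sub>m\<^sup>q\<close>, \<open>q = p\<^sup>m\<close>, spans \<open>k(D\<^sub>m\<^sub>+\<^sub>n\<^sup>q) = D\<^sub>n\<close> over \<open>k = D\<^sub>0\<close>; both degrees are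
  \<open>d\<^sup>n\<close>, so it stays independent over \<open>k\<close>.\<close>

lemma modular_constant_chain:
  assumes fd: "\<And>n. fin_dim (D n) (D (Suc n))" "\<And>n. fdim (D n) (D (Suc n)) = d"
  shows "modular p k (\<Union>n. D n)"
  unfolding modular_def lin_disjoint_def
proof (intro allI impI)
  fix m S
  let ?M = "\<Union>n. D n" let ?q = "p ^ m"
  assume S: "S \<subseteq> pow_set ?q ?M" "lin_indep (k \<inter> pow_set ?q ?M) S"
  show "lin_indep k S"
  proof (rule lin_indep_finite_subsets)
    fix T assume T: "finite T" "T \<subseteq> S"
    have "T \<subseteq> (\<Union>n. pow_set ?q (D n))" using T S unfolding pow_set_def by blast
    then obtain N where N: "T \<subseteq> pow_set ?q (D N)"
      using finite_subset_Union_chain[of "\<lambda>n. pow_set ?q (D n)" T] T D_inc pow_set_mono by metis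
    let ?F = "pow_set ?q (D m)" and ?V = "pow_set ?q (D (m + N))"
    have F: "subfield ?F" using sf_D subfield_pow_set by blast
    \<comment> \<open>With second index \<open>0\<close>, \<open>chain_kpow\<close> reads
      \<open>k(D_m^q) = D 0 = k\<close>.\<close>
    have Fk: "?F \<subseteq> k" using kpow_superset(2)[of m "D m"] chain_kpow[of m 0] D_0 by simp
    have TV: "T \<subseteq> ?V" using N pow_set_mono[OF chain_mono[of N "m + N"]] by auto
    \<comment> \<open>Independence is first weakened to the subfield \<open>?F\<close>, over which
      the degree of \<open>?V\<close> is known.\<close>
    have "?F \<subseteq> k \<inter> pow_set ?q ?M" using Fk pow_set_mono[of "D m" ?M] by auto
    hence ind: "lin_indep ?F T" using S T lin_indep_antimono lin_indep_subset by blast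
    have V: "fin_dim ?F ?V" "fdim ?F ?V = d ^ N"
      using fdim_pow_set[OF sf_D, of m "D (m + N)" m] chain_fdim_power[OF fd, of m N] by auto
    obtain Y where Y: "T \<subseteq> Y" "basis ?F ?V Y" using fin_dim_extend[OF F V(1) ind TV] by auto
    have "lspan k Y = lspan k ?V"
      using lspan_lspan[OF sf_k Fk F, of Y] Y by (simp add: basis_def)
    also have "\<dots> = D N" using chain_kpow[of m N] by (simp add: kpow_def)
    finally have "fdim k (lspan k Y) = card Y"
      using chain_fdim_power[OF fd, of 0 N] D_0 basis_fdim[OF F Y(2)] V(2) by simp
    hence "lin_indep k Y" using Y by (intro lin_indep_spanning_card sf_k) (auto simp: basis_def)
    thus "lin_indep k T" using Y lin_indep_subset by blast
  qed
qed

end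

end

context bounded_gen
begin

lemma lq_modular_chain:
  assumes D_0: "D 0 = k" and sf_D: "\<And>n. subfield (D n)" and D_sub: "\<And>n. D n \<subseteq> K"
    and D_inc: "\<And>n. D n \<subseteq> D (Suc n)" and D_pow: "\<And>n. kpow p k 1 (D (Suc n)) = D n"
  shows "lq_modular p k (\<Union>n. D n)"
proof -
  note mono = chain_mono[OF assms]
  have kD: "k \<subseteq> D n" for n using mono[of 0 n] D_0 by simp
  have fd: "fin_dim (D n) (D (Suc n)) \<and> fdim (D n) (D (Suc n)) \<le> p ^ B" for n
    using fdim_kpow_le[OF sf_D kD D_sub, of "Suc n"] D_pow by simp
  \<comment> \<open>Frobenius carries the upper extension to one of \<open>p\<close>-th powers with
    the same degree. Its compositum with \<open>D n\<close> is \<open>D (Suc n)\<close>, and passing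
    to a compositum cannot raise the degree.\<close>
  have step: "fdim (D n) (D (Suc n)) \<le> fdim (D (Suc n)) (D (Suc (Suc n)))" for n
  proof -
    let ?P = "\<lambda>i. pow_set (p ^ 1) (D i)"
    have fr: "fin_dim (?P (Suc n)) (?P (Suc (Suc n)))"
      "fdim (?P (Suc n)) (?P (Suc (Suc n))) = fdim (D (Suc n)) (D (Suc (Suc n)))"
      using fdim_pow_set[OF sf_D, of "Suc n" "D (Suc (Suc n))" 1] fd by auto
    have sub: "?P (Suc i) \<subseteq> D i" for i using kpow_superset(2)[of 1 "D (Suc i)"] D_pow by simp
    have "lspan (D n) (?P (Suc (Suc n))) = D (Suc n)"
    proof
      show "lspan (D n) (?P (Suc (Suc n))) \<subseteq> D (Suc n)" by (intro lspan_in_subfield sf_D D_inc sub)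
      show "D (Suc n) \<subseteq> lspan (D n) (?P (Suc (Suc n)))"
        unfolding D_pow[of "Suc n", symmetric] kpow_def[of p k 1] using kD by (intro lspan_mono) auto
    qed
    thus ?thesis
      using fdim_compositum[OF subfield_pow_set[OF sf_D] sf_D sub fr(1)] fr(2) by simp
  qed
  obtain a where a: "\<And>n. n \<ge> a \<Longrightarrow> fdim (D n) (D (Suc n)) = fdim (D a) (D (Suc a))"
    using bounded_mono_constant[of "\<lambda>n. fdim (D n) (D (Suc n))" "p ^ B"] step fd by blast
  \<comment> \<open>The degrees are constant from \<open>a\<close> on, so the chain is restarted
    with base field \<open>D a\<close>; the relation between consecutive terms survives this change
    of base.\<close>
  interpret A: pins p "D a" K using sf_D kD D_sub by (intro pins_base)
  let ?D = "\<lambda>n. D (a + n)"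
  have "modular p (D a) (\<Union>n. ?D n)"
  proof (rule A.modular_constant_chain)
    fix n
    show "kpow p (D a) 1 (?D (Suc n)) = ?D n"
    proof
      show "kpow p (D a) 1 (?D (Suc n)) \<subseteq> ?D n"
        using kpow_superset(2)[of 1 "D (Suc (a + n))"] D_pow[of "a + n"] mono[of a "a + n"]
        unfolding kpow_def[of p "D a"] by (intro lspan_in_subfield sf_D) auto
      show "?D n \<subseteq> kpow p (D a) 1 (?D (Suc n))"
        using D_pow[of "a + n"] kpow_mono[OF kD[of a] order_refl, of p 1 "D (Suc (a + n))"] by simp
    qed
    show "fdim (?D n) (?D (Suc n)) = fdim (D a) (D (Suc a))" using a[of "a + n"] by simp
  qed (use fd sf_D D_sub D_inc in auto)
  moreover have "(\<Union>n. ?D n) = (\<Union>n. D n)"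
    using mono[OF le_add2] by (intro subset_antisym UN_least) (auto intro: UN_I)
  moreover have "fin_dim k (D a)"
  proof (induction a)
    case 0 thus ?case using fdim_self[OF sf_k] D_0 by simp
  next
    case (Suc a) thus ?case using fdim_tower[OF sf_k sf_D[of a]] fd[of a] by simp
  qed
  moreover have "subfield (\<Union>n. D n)" by (intro subfield_Union_chain sf_D D_inc)
  ultimately show ?thesis
    unfolding lq_modular_def finite_ext_iff field_ext_def using sf_k sf_D kD by (intro exI[of _ "D a"]) auto
qed

end


section \<open>The largest lq-modular relatively perfect subextension\<close>

lemma finite_ext_trans: "finite_ext k L \<Longrightarrow> finite_ext L M \<Longrightarrow> finite_ext k M"
  unfolding finite_ext_iff field_ext_def using fdim_tower by blast

lemma lq_modular_finite_base: "finite_ext k L \<Longrightarrow> lq_modular p L M \<Longrightarrow> lq_modular p k M"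
  unfolding lq_modular_def using finite_ext_trans by blast

lemma adjoin_Union_chain:
  assumes inc: "\<And>n::nat. D n \<subseteq> D (Suc n)"
  shows "adjoin (\<Union>n. D n) G = (\<Union>n. adjoin (D n) G)"
proof
  have D: "D n \<subseteq> adjoin (D n) G" "G \<subseteq> adjoin (D n) G" for n by (rule adjoin_superset)+
  show "adjoin (\<Union>n. D n) G \<subseteq> (\<Union>n. adjoin (D n) G)"
  proof (intro adjoin_minimal)
    show "subfield (\<Union>n. adjoin (D n) G)"
      using inc by (intro subfield_Union_chain subfield_adjoin adjoin_mono) auto
  qed (use D in blast)+
  show "(\<Union>n. adjoin (D n) G) \<subseteq> adjoin (\<Union>n. D n) G" by (intro UN_least adjoin_mono) auto
qed

section \<open>Root parts and the construction of the maximal subextension\<close>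

context pins
begin

lemma root_part_subfield: "subfield (root_part p k K n)"
proof -
  have neg: "(- x) ^ (p ^ n) = - (x ^ (p ^ n))" for x :: 'a
    using frob_diff[of 0 x n] by (simp add: frob_0 del: power_eq_0_iff)
  show ?thesis using subfieldD[OF sf_k] subfieldD[OF sf_K]
    by (simp add: root_part_def subfield_def frob_0 frob_add neg power_mult_distrib power_inverse del: power_eq_0_iff)
qed

lemma root_part_superset: "k \<subseteq> root_part p k K n"
  using k_sub subfield_power[OF sf_k] by (auto simp: root_part_def)

lemma root_part_sub_K: "root_part p k K n \<subseteq> K"
  by (auto simp: root_part_def)

lemma root_part_inc: "root_part p k K n \<subseteq> root_part p k K (Suc n)"
  using power_p_mono[of _ n "Suc n"] by (auto simp: root_part_def)

lemma root_part_pow: "pow_set (p ^ m) (root_part p k K (m + n)) \<subseteq> root_part p k K n"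
proof
  fix y assume "y \<in> pow_set (p ^ m) (root_part p k K (m + n))"
  then obtain x where x: "y = x ^ (p ^ m)" "x \<in> K" "x ^ (p ^ (m + n)) \<in> k"
    by (auto simp: pow_set_def root_part_def)
  thus "y \<in> root_part p k K n" using subfield_power[OF sf_K] frob_pow[of x m n] by (simp add: root_part_def)
qed

lemma kpow_root_part: "kpow p k m (root_part p k K (m + n)) \<subseteq> root_part p k K n"
  unfolding kpow_def by (intro lspan_in_subfield root_part_subfield root_part_superset root_part_pow)

text \<open>Independence over \<open>D = k(R^(p^j))\<close>, \<open>R\<close> the root part, becomes independence over
  \<open>k \<inter> K^(p^(m+j)) \<subseteq> D^(p^m)\<close> after raising to the power \<open>p^m\<close>, hence over \<open>k\<close> by modularity. As
  \<open>x^(p^m) \<in> k\<close>, only the coefficient of \<open>1\<close> survives in an expansion of \<open>x\<close> over \<open>D\<close>.\<close>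

lemma modular_descend:
  assumes mod: "modular p k K" and x: "x \<in> kpow p k j K" "x ^ (p ^ m) \<in> k"
  shows "x \<in> kpow p k j (root_part p k K (m + j))"
proof -
  let ?R = "root_part p k K (m + j)" let ?D = "kpow p k j ?R"
  have D: "subfield ?D" "k \<subseteq> ?D"
    using kpow_subfield[OF root_part_subfield root_part_sub_K] kpow_superset(1)[OF root_part_subfield] by auto
  have Dk: "pow_set (p ^ m) ?D \<subseteq> k"
    unfolding kpow_def by (rule pow_set_lspan_subset) (auto simp: pow_set_def root_part_def frob_pow add.commute)
  obtain T where T: "finite T" "T \<subseteq> pow_set (p ^ j) K" "x \<in> lspan k T"
    using lspan_finite_subset[OF sf_k] x(1) unfolding kpow_def by blast
  \<comment> \<open>Extending \<open>{1}\<close> forces \<open>1\<close> into the basis, so that its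
    coefficient can be split off from \<open>x\<close>.\<close>
  have "lin_indep ?D {1}" by (auto simp: lin_indep_def subset_singleton_iff)
  from basis_extend[OF D(1) _ this T(1)] obtain S
    where S: "1 \<in> S" "S \<subseteq> insert 1 T" "basis ?D (lspan ?D (insert 1 T)) S" by auto
  have SK: "S \<subseteq> pow_set (p ^ j) K"
    using S(2) T(2) subfieldD(2)[OF subfield_pow_set[OF sf_K]] by blast
  let ?S = "pow_set (p ^ m) S"
  have "lin_indep (pow_set (p ^ m) ?D) ?S" using S(3) lin_indep_pow_set by (simp add: basis_def)
  \<comment> \<open>The \<open>p^(m+j)\<close>-th root \<open>w\<close> of such an element lies in
    \<open>?R\<close>, and \<open>w^(p^j)\<close> is then the required element of
    \<open>?D\<close>.\<close>
  moreover have "k \<inter> pow_set (p ^ (m + j)) K \<subseteq> pow_set (p ^ m) ?D"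
  proof
    fix f assume "f \<in> k \<inter> pow_set (p ^ (m + j)) K"
    then obtain w where w: "w \<in> ?R" "f = w ^ (p ^ (m + j))" by (auto simp: pow_set_def root_part_def)
    have "w ^ (p ^ j) \<in> ?D" using w(1) kpow_superset(2)[of j ?R] by (auto simp: pow_set_def)
    moreover have "f = (w ^ (p ^ j)) ^ (p ^ m)" using w(2) by (simp add: frob_pow add.commute)
    ultimately show "f \<in> pow_set (p ^ m) ?D" by (auto simp: pow_set_def)
  qed
  ultimately have "lin_indep (k \<inter> pow_set (p ^ (m + j)) K) ?S" by (rule lin_indep_antimono)
  moreover have "?S \<subseteq> pow_set (p ^ (m + j)) K"
    using pow_set_mono[OF SK, of "p ^ m"] by (simp add: pow_set_pow_set power_add mult.commute)
  ultimately have ind: "lin_indep k ?S" using mod unfolding modular_def lin_disjoint_def by blast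
  let ?S1 = "S - {1}"
  have ins: "S = insert 1 ?S1" using S(1) by auto
  have "lspan k T \<subseteq> lspan ?D (insert 1 T)" using D(2) by (intro lspan_mono) auto
  hence "x \<in> lspan ?D (insert 1 ?S1)" using T(3) S(3) ins by (auto simp: basis_def)
  then obtain c where c: "c \<in> ?D" "x - c * 1 \<in> lspan ?D ?S1" using lspan_insert_iff[OF D(1)] by blast
  let ?y = "x - c"
  have "?y ^ (p ^ m) \<in> pow_set (p ^ m) (lspan ?D ?S1)" using c by (auto simp: pow_set_def)
  hence y1: "?y ^ (p ^ m) \<in> lspan k (pow_set (p ^ m) ?S1)"
    using lspan_mono[OF Dk order_refl, of "pow_set (p ^ m) ?S1"] by (auto simp: pow_set_lspan)
  have "c ^ (p ^ m) \<in> k" using c Dk by (auto simp: pow_set_def)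
  hence yk: "?y ^ (p ^ m) \<in> k" using x(2) sf_k by (auto simp: frob_diff subfieldD)
  have "1 \<notin> pow_set (p ^ m) ?S1"
  proof
    assume "1 \<in> pow_set (p ^ m) ?S1"
    then obtain s where s: "s \<in> ?S1" "1 = s ^ (p ^ m)" unfolding pow_set_def by blast
    thus False using injD[OF frob_inj, of s m 1] by simp
  qed
  moreover have "?S = insert 1 (pow_set (p ^ m) ?S1)"
    unfolding pow_set_def by (subst ins) (simp only: image_insert power_one)
  ultimately have nin: "1 \<notin> lspan k (pow_set (p ^ m) ?S1)" using lin_indep_insertD[OF sf_k] ind by metis
  \<comment> \<open>A nonzero value would be an element of \<open>k\<close> in the span of the
    powers of \<open>?S1\<close>; dividing by it would put \<open>1\<close> into that span.\<close>
  have "?y ^ (p ^ m) = 0"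
  proof (rule ccontr)
    assume "?y ^ (p ^ m) \<noteq> 0"
    moreover have "?y ^ (p ^ m) * 1 \<in> lspan k (pow_set (p ^ m) ?S1)" using y1 by (simp only: mult_1_right)
    ultimately show False using lspan_unscale[OF sf_k yk] nin by blast
  qed
  hence "x = c" by simp
  thus ?thesis using c(1) by simp
qed

text \<open>\<open>core m\<close> and \<open>core_union\<close> are the \<open>A_m\<close> and
  \<open>H\<close> of the introductory comment.\<close>

definition core :: "nat \<Rightarrow> 'a set" where
  "core m = (\<Inter>j. kpow p k j (root_part p k K (m + j)))"

definition core_union :: "'a set" where
  "core_union = (\<Union>m. core m)"

text \<open>Apply \<open>modular_descend\<close> over \<open>F'\<close>, then raise to the power
  \<open>p^c\<close>: this moves the coefficients from \<open>F'\<close> into \<open>k\<close> and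
  the root parts over \<open>F'\<close> into root parts over \<open>k\<close> of the same
  index.\<close>

lemma modular_core:
  assumes F': "purely_insep p F' N" "modular p F' N" "pow_set (p ^ c) F' \<subseteq> k" "N \<subseteq> K"
    and x: "x \<in> N" "\<And>j. x \<in> kpow p F' j N"
  shows "x ^ (p ^ c) \<in> core_union"
proof -
  interpret N: pins p F' N using F'(1) by unfold_locales
  \<comment> \<open>This \<open>m\<close> does not depend on \<open>j\<close>, so all memberships
    below concern the single field \<open>core m\<close>.\<close>
  obtain m where m: "x ^ (p ^ m) \<in> F'" using N.insep_ex x by auto
  have "x ^ (p ^ c) \<in> kpow p k j (root_part p k K (m + j))" for j
  proof -
    let ?R = "root_part p F' N (m + j)"
    have "x \<in> kpow p F' j ?R" by (rule N.modular_descend[OF F'(2) x(2) m])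
    hence "x ^ (p ^ c) \<in> pow_set (p ^ c) (kpow p F' j ?R)" by (auto simp: pow_set_def)
    also have "\<dots> = lspan (pow_set (p ^ c) F') (pow_set (p ^ j) (pow_set (p ^ c) ?R))"
      by (simp add: kpow_def pow_set_lspan pow_set_pow_set mult.commute)
    also have "\<dots> \<subseteq> lspan k (pow_set (p ^ j) (root_part p k K (m + j)))"
    proof (intro lspan_mono pow_set_mono F'(3) subsetI)
      fix z assume "z \<in> pow_set (p ^ c) ?R"
      then obtain y where y: "z = y ^ (p ^ c)" "y \<in> K" "y ^ (p ^ (m + j)) \<in> F'"
        using F'(4) by (auto simp: pow_set_def root_part_def)
      have "z ^ (p ^ (m + j)) = (y ^ (p ^ (m + j))) ^ (p ^ c)" using y(1) by (simp add: frob_pow add.commute)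
      thus "z \<in> root_part p k K (m + j)"
        using y F'(3) subfield_power[OF sf_K] by (auto simp: root_part_def pow_set_def)
    qed
    finally show ?thesis by (simp add: kpow_def)
  qed
  thus ?thesis by (auto simp: core_union_def core_def)
qed

end

context bounded_gen
begin

text \<open>The \<open>p^m\<close>-th powers of the root part lie in \<open>k\<close>, so
  \<open>fin_dim_kpow\<close> at \<open>j = m\<close> already measures its degree over
  \<open>k\<close>.\<close>

lemma fin_dim_root_part: "fin_dim k (root_part p k K m)"
proof -
  have "kpow p k m (root_part p k K m) = k"
  proof
    show "kpow p k m (root_part p k K m) \<subseteq> k" using kpow_root_part[of m 0] by (auto simp: root_part_def)
  qed (rule kpow_superset(1)[OF root_part_subfield])
  thus ?thesis using fin_dim_kpow[OF root_part_subfield root_part_superset root_part_sub_K, of m m] by simp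
qed

lemma kpow_root_part_antimono:
  assumes "i \<le> j"
  shows "kpow p k j (root_part p k K (m + j)) \<subseteq> kpow p k i (root_part p k K (m + i))"
proof -
  have "kpow p k (j - i) (root_part p k K ((j - i) + (m + i))) \<subseteq> root_part p k K (m + i)"
    by (rule kpow_root_part)
  hence "kpow p k i (kpow p k (j - i) (root_part p k K ((j - i) + (m + i)))) \<subseteq> kpow p k i (root_part p k K (m + i))"
    by (rule kpow_mono[OF order_refl])
  thus ?thesis using assms by (simp add: kpow_kpow add.commute)
qed

text \<open>The fields decrease with \<open>j\<close> and lie between \<open>k\<close> and the
  \<open>m\<close>-th root part, which is finite over \<open>k\<close>.\<close>

lemma core_stable: "\<exists>J. \<forall>j\<ge>J. core m = kpow p k j (root_part p k K (m + j))"
proof -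
  let ?C = "\<lambda>j. kpow p k j (root_part p k K (m + j))"
  have "\<exists>J. \<forall>j\<ge>J. ?C j = ?C J"
  proof (rule decreasing_stabilizes[OF sf_k])
    show "subfield (?C j)" for j by (intro kpow_subfield root_part_subfield root_part_sub_K)
    show "k \<subseteq> ?C j" for j by (intro kpow_superset root_part_subfield)
    show "fin_dim k (?C 0)" using fin_dim_root_part[of m] by (simp add: kpow_0 root_part_subfield root_part_superset)
  qed (rule kpow_root_part_antimono)
  then obtain J where J: "\<And>j. j \<ge> J \<Longrightarrow> ?C j = ?C J" by blast
  have "core m = ?C J" unfolding core_def
  proof
    show "?C J \<subseteq> (\<Inter>j. ?C j)"
    proof (intro INF_greatest)
      fix j show "?C J \<subseteq> ?C j"
        using J[of j] kpow_root_part_antimono[of j J m] by (cases "j \<ge> J") auto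
    qed
  qed auto
  thus ?thesis using J by metis
qed

lemma core_subfield: "subfield (core m)"
  using core_stable[of m] kpow_subfield[OF root_part_subfield root_part_sub_K] by (metis order_refl)

lemma core_superset: "k \<subseteq> core m"
  unfolding core_def by (intro INF_greatest kpow_superset root_part_subfield)

lemma core_root_part: "core m \<subseteq> root_part p k K m"
  using kpow_0[OF root_part_subfield root_part_superset, of m] INF_lower[of 0 UNIV "\<lambda>j. kpow p k j (root_part p k K (m + j))"]
  by (simp add: core_def)

lemma core_sub_K: "core m \<subseteq> K"
  using core_root_part root_part_sub_K by blast

lemma core_inc: "core m \<subseteq> core (Suc m)"
  unfolding core_def add_Suc by (intro INF_superset_mono kpow_mono root_part_inc order_refl)

lemma core_0: "core 0 = k"
  using core_root_part[of 0] core_superset[of 0] by (auto simp: root_part_def)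

lemma core_pow: "kpow p k 1 (core (Suc m)) = core m"
proof -
  obtain J J' where J: "\<And>j. j \<ge> J \<Longrightarrow> core m = kpow p k j (root_part p k K (m + j))"
    "\<And>j. j \<ge> J' \<Longrightarrow> core (Suc m) = kpow p k j (root_part p k K (Suc m + j))"
    using core_stable[of m] core_stable[of "Suc m"] by blast
  let ?j = "max J J'"
  \<comment> \<open>The off-by-one is deliberate: \<open>m + Suc ?j = Suc m + ?j\<close>, so both
    cores are read off from the same root part.\<close>
  have "core m = kpow p k (Suc ?j) (root_part p k K (m + Suc ?j))" by (rule J(1)) simp
  also have "\<dots> = kpow p k 1 (kpow p k ?j (root_part p k K (Suc m + ?j)))" by (simp add: kpow_kpow)
  also have "\<dots> = kpow p k 1 (core (Suc m))" using J(2)[of ?j] by simp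
  finally show ?thesis by simp
qed

lemma core_union_subfield: "subfield core_union"
  unfolding core_union_def by (intro subfield_Union_chain core_subfield core_inc)

lemma core_union_superset: "k \<subseteq> core_union"
  using core_superset[of 0] by (auto simp: core_union_def)

lemma core_union_sub_K: "core_union \<subseteq> K"
  using core_sub_K by (auto simp: core_union_def)

lemma rel_perfect_core_union: "rel_perfect p k core_union"
  unfolding rel_perfect_def
proof (rule adjoin_self[OF core_union_subfield core_union_superset])
  show "pow_set p core_union \<subseteq> core_union" by (rule pow_set_subset[OF core_union_subfield order_refl])
  show "core_union \<subseteq> adjoin k (pow_set p core_union)" unfolding core_union_def
  proof (rule UN_least)
    fix m
    have "core m = kpow p k 1 (core (Suc m))" by (rule core_pow[symmetric])
    also have "\<dots> = adjoin k (pow_set p (core (Suc m)))" using kpow_eq_adjoin[OF core_subfield core_sub_K] by simp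
    also have "\<dots> \<subseteq> adjoin k (pow_set p (\<Union>m. core m))" by (intro adjoin_mono pow_set_mono) auto
    finally show "core m \<subseteq> adjoin k (pow_set p (\<Union>m. core m))" .
  qed
qed

text \<open>With base field \<open>k(G)\<close>, the fields \<open>core n\<close> with
  \<open>G\<close> adjoined again form a chain to which \<open>lq_modular_chain\<close> applies. The
  case of nonempty \<open>G\<close> serves the last step of a chain, where \<open>K\<close> is only
  finite over the union.\<close>

lemma lq_modular_adjoin_core_union:
  assumes G: "finite G" "G \<subseteq> K"
  shows "lq_modular p k (adjoin core_union G)"
proof -
  let ?D = "\<lambda>n. adjoin (core n) G" let ?L = "?D 0"
  have L: "?L = adjoin k G" by (simp add: core_0)
  have sup: "core n \<subseteq> ?D n" "G \<subseteq> ?D n" for n by (rule adjoin_superset)+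
  have sub: "?D n \<subseteq> K" for n by (intro adjoin_minimal sf_K core_sub_K G)
  have inc: "?D n \<subseteq> ?D (Suc n)" for n by (intro adjoin_mono core_inc order_refl)
  have L_sub: "?L \<subseteq> ?D n" for n using core_superset by (intro adjoin_mono) (auto simp: core_0)
  have kL: "k \<subseteq> ?L" using L adjoin_superset(1) by simp
  interpret L: bounded_gen p ?L K B by (intro bounded_gen_base subfield_adjoin kL sub)
  have "lq_modular p ?L (\<Union>n. ?D n)"
  proof (rule L.lq_modular_chain)
    fix n
    show "kpow p ?L 1 (?D (Suc n)) = ?D n"
    proof
      have "pow_set (p ^ 1) (core (Suc n)) \<subseteq> ?D n"
        using kpow_superset(2)[of 1 "core (Suc n)"] sup(1)[of n] unfolding core_pow by blast
      moreover have "pow_set (p ^ 1) G \<subseteq> ?D n" by (intro pow_set_subset subfield_adjoin sup)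
      ultimately show "kpow p ?L 1 (?D (Suc n)) \<subseteq> ?D n"
        unfolding kpow_def by (intro lspan_in_subfield subfield_adjoin L_sub pow_set_adjoin_subset)
      have "core n \<subseteq> kpow p ?L 1 (?D (Suc n))"
        unfolding core_pow[of n, symmetric] by (intro kpow_mono kL sup)
      moreover have "G \<subseteq> kpow p ?L 1 (?D (Suc n))"
        using L.kpow_superset(1)[OF subfield_adjoin, of 1 "core (Suc n)" G] sup(2)[of 0] by (rule order_trans[rotated])
      ultimately show "?D n \<subseteq> kpow p ?L 1 (?D (Suc n))"
        by (intro adjoin_minimal L.kpow_subfield subfield_adjoin sub)
    qed
  qed (use sub inc in \<open>auto simp: subfield_adjoin\<close>)
  moreover have "finite_ext k ?L"
    unfolding finite_ext_iff field_ext_def L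
    using adjoin_fin_dim[OF G] sf_k subfield_adjoin adjoin_superset(1) by blast
  ultimately show ?thesis
    unfolding core_union_def using adjoin_Union_chain[of core G, OF core_inc] lq_modular_finite_base by metis
qed

lemma lq_modular_core_union: "lq_modular p k core_union"
  using lq_modular_adjoin_core_union[of "{}"] by (simp add: adjoin_empty core_union_subfield)

text \<open>Relative perfection gives \<open>M = k(M^(p^j))\<close> for all \<open>j\<close>, so
  \<open>modular_core\<close> applies to every element of \<open>M\<close> and puts
  \<open>M^(p^c)\<close> into \<open>core_union\<close>. Perfection once more recovers
  \<open>M\<close> as \<open>k(M^(p^c))\<close>.\<close>

lemma H_good_subset_core_union:
  assumes M: "H_good p k K M" shows "M \<subseteq> core_union"
proof -
  obtain k' where k': "field_ext k' M" "finite_ext k k'" "modular p k' M"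
    using M by (auto simp: H_good_def lq_modular_def)
  have sf: "subfield k'" "subfield M" "k \<subseteq> k'" "k' \<subseteq> M" "M \<subseteq> K" "fin_dim k k'"
    using k' M by (auto simp: H_good_def field_ext_def finite_ext_iff)
  have kM: "k \<subseteq> M" using sf by auto
  obtain c where c: "pow_set (p ^ c) k' \<subseteq> k" using fin_dim_exponent sf by blast
  have 1: "kpow p k 1 M = M"
    using M kpow_eq_adjoin[OF sf(2,5)] by (simp add: H_good_def rel_perfect_def)
  have perf: "kpow p k j M = M" for j
  proof (induction j)
    case (Suc j) thus ?case using kpow_kpow[of j 1 M] 1 by simp
  qed (simp add: kpow_0 sf kM)
  have "purely_insep p k' M" using sf insep_ex unfolding purely_insep_def field_ext_def by blast
  moreover have "x \<in> kpow p k' j M" if "x \<in> M" for x j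
    using that perf[of j] kpow_mono[OF sf(3) order_refl[of M], of p j] by auto
  ultimately have "x ^ (p ^ c) \<in> core_union" if "x \<in> M" for x
    using that by (intro modular_core[OF _ k'(3) c sf(5)]) auto
  hence "pow_set (p ^ c) M \<subseteq> core_union" by (auto simp: pow_set_def)
  hence "kpow p k c M \<subseteq> core_union"
    unfolding kpow_def by (intro lspan_in_subfield core_union_subfield core_union_superset)
  thus ?thesis by (simp add: perf)
qed

text \<open>This shows that the description in \<open>Hmax\<close> has a unique solution:
  \<open>core_union\<close> is itself \<open>H_good\<close> and contains every other
  candidate.\<close>

lemma Hmax_eq_core_union: "Hmax p k K = core_union"
  unfolding Hmax_def
proof (rule the_equality)
  have "H_good p k K core_union"
    using sf_k core_union_subfield core_union_superset core_union_sub_K lq_modular_core_union rel_perfect_core_union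
    by (simp add: H_good_def field_ext_def)
  thus *: "H_good p k K core_union \<and> (\<forall>M'. H_good p k K M' \<longrightarrow> M' \<subseteq> core_union)"
    using H_good_subset_core_union by blast
  show "M = core_union" if "H_good p k K M \<and> (\<forall>M'. H_good p k K M' \<longrightarrow> M' \<subseteq> M)" for M
    using that * by blast
qed

text \<open>Generators \<open>G\<close> of \<open>N\<close> over \<open>k(N^p)\<close> generate \<open>N\<close> over every \<open>k(N^(p^j))\<close>; so the sequence stops
  once \<open>G^(p^c) \<subseteq> k\<close>.\<close>

lemma kpow_stable:
  assumes N: "subfield N" "k \<subseteq> N" "N \<subseteq> K"
  shows "\<exists>c G. finite G \<and> G \<subseteq> N \<and> N \<subseteq> adjoin (kpow p k c N) G \<and> (\<forall>j. kpow p k (c + j) N = kpow p k c N)"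
proof -
  have sfk: "subfield (kpow p k j N)" for j by (intro kpow_subfield N)
  obtain G where G: "finite G" "lspan (kpow p k 1 N) G = N"
    using fdim_kpow_le[OF N] by (auto simp: fin_dim_def basis_def)
  have GN: "G \<subseteq> N" using G(2) lspan_base[OF sfk] by blast
  have gen: "N \<subseteq> adjoin (kpow p k j N) G" for j
  proof (induction j)
    case 0 thus ?case using adjoin_superset(1)[of N G] by (simp add: kpow_0 N)
  next
    case (Suc j)
    let ?E = "adjoin (kpow p k (Suc j) N) G"
    have "pow_set (p ^ 1) (kpow p k j N) \<subseteq> kpow p k 1 (kpow p k j N)" by (rule kpow_superset(2))
    hence "pow_set (p ^ 1) (kpow p k j N) \<subseteq> ?E" using adjoin_superset(1) by (simp add: kpow_kpow) blast
    moreover have "pow_set (p ^ 1) G \<subseteq> ?E" by (intro pow_set_subset subfield_adjoin adjoin_superset)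
    ultimately have "pow_set (p ^ 1) (adjoin (kpow p k j N) G) \<subseteq> ?E" by (intro pow_set_adjoin_subset subfield_adjoin)
    hence "pow_set (p ^ 1) N \<subseteq> ?E" using pow_set_mono[OF Suc] by blast
    moreover have "k \<subseteq> ?E" by (rule order_trans[OF kpow_superset(1)[OF N(1)] adjoin_superset(1)])
    ultimately have "kpow p k 1 N \<subseteq> ?E" unfolding kpow_def[of p k 1] by (intro lspan_in_subfield subfield_adjoin)
    hence "lspan (kpow p k 1 N) G \<subseteq> ?E" by (intro lspan_in_subfield subfield_adjoin adjoin_superset)
    thus ?case using G by simp
  qed
  have GK: "G \<subseteq> K" using GN N by auto
  obtain c where c: "\<forall>x\<in>G. x ^ (p ^ c) \<in> k" using common_exponent[OF G(1) GK] by auto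
  have "kpow p k (c + j) N = kpow p k c N" for j
  proof
    show "kpow p k (c + j) N \<subseteq> kpow p k c N" by (intro kpow_antimono N) simp
    let ?E = "kpow p k (c + j) N"
    have kE: "k \<subseteq> ?E" by (rule kpow_superset(1)[OF N(1)])
    have "pow_set (p ^ c) (kpow p k j N) \<subseteq> ?E" using kpow_superset(2)[of c "kpow p k j N"] by (simp add: kpow_kpow)
    moreover have "pow_set (p ^ c) G \<subseteq> ?E" using c kE by (auto simp: pow_set_def)
    ultimately have "pow_set (p ^ c) (adjoin (kpow p k j N) G) \<subseteq> ?E" by (intro pow_set_adjoin_subset sfk)
    hence "pow_set (p ^ c) N \<subseteq> ?E" using pow_set_mono[OF gen] by blast
    thus "kpow p k c N \<subseteq> ?E" unfolding kpow_def[of p k c] by (intro lspan_in_subfield sfk kE)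
  qed
  thus ?thesis using G(1) GN gen[of c] by blast
qed

end


section \<open>Chains of lq-modular extensions\<close>

lemma finite_ext_adjoin:
  assumes "finite_ext L K" shows "\<exists>G\<subseteq>K. finite G \<and> adjoin L G = K"
proof -
  have L: "subfield L" "subfield K" "L \<subseteq> K" using assms by (auto simp: finite_ext_def field_ext_def)
  obtain G where G: "finite G" "lspan L G = K" using assms by (auto simp: finite_ext_iff fin_dim_def basis_def)
  have GK: "G \<subseteq> K" using G(2) lspan_base[OF L(1)] by blast
  have "K \<subseteq> adjoin L G" unfolding G(2)[symmetric] by (intro lspan_in_subfield subfield_adjoin adjoin_superset)
  thus ?thesis using adjoin_self[OF L(2,3) GK] G(1) GK by blast
qed

context pins
begin

lemma finite_extI: "finite G \<Longrightarrow> G \<subseteq> K \<Longrightarrow> K \<subseteq> adjoin k G \<Longrightarrow> finite_ext k K"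
  using adjoin_fin_dim[of G] adjoin_self[OF sf_K k_sub, of G] sf_k sf_K k_sub by (simp add: finite_ext_iff field_ext_def)

text \<open>The constant chain has all degrees \<open>1\<close>. Such trivial steps pad a chain that
  reaches \<open>K\<close> early.\<close>

lemma lq_modular_self: "lq_modular p K K"
proof -
  interpret K: pins p K K by (intro pins_base sf_K k_sub order_refl)
  have "kpow p K 1 K = K"
    by (intro subset_antisym K.kpow_subset K.kpow_superset sf_K order_refl)
  hence "modular p K (\<Union>n::nat. K)"
    using fdim_self[OF sf_K] by (intro K.modular_constant_chain[where d = 1]) (auto simp: sf_K)
  moreover have "finite_ext K K" using fdim_self[OF sf_K] by (simp add: finite_ext_iff field_ext_def sf_K)
  ultimately show ?thesis unfolding lq_modular_def by (intro exI[of _ K]) (simp add: field_ext_def sf_K)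
qed

text \<open>A finite subset of \<open>K\<close> lies in a single root part, whose small generating
  set serves as \<open>T\<close>.\<close>

lemma bounded_gen_q_finite:
  assumes "q_finite p k K" shows "\<exists>B. bounded_gen p k K B"
proof -
  obtain B where B: "\<And>n. \<exists>G. min_gen k (root_part p k K n) G \<and> finite G \<and> card G \<le> B"
    using assms unfolding q_finite_def by blast
  have "bounded_gen p k K B"
  proof unfold_locales
    fix S assume S: "finite S" "S \<subseteq> K"
    obtain n where n: "\<forall>x\<in>S. x ^ (p ^ n) \<in> k" using common_exponent[OF S] by blast
    obtain G where G: "min_gen k (root_part p k K n) G" "finite G" "card G \<le> B" using B[of n] by blast
    have "S \<subseteq> adjoin k G" "G \<subseteq> K" using n S(2) G(1) by (auto simp: min_gen_def root_part_def)
    thus "\<exists>T\<subseteq>K. finite T \<and> card T \<le> B \<and> S \<subseteq> adjoin k T" using G(2,3) by blast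
  qed
  thus ?thesis by blast
qed

end

context bounded_gen
begin

text \<open>\<open>F\<close> and \<open>k\<close> are linked only by
  \<open>F \<subseteq> k(G)\<close>; in the application they are \<open>F_j\<close> and
  \<open>H_j\<close>. \<open>N\<close> is finitely generated over the stable field
  \<open>?R = F'(N^(p^d))\<close>, and \<open>modular_core\<close> controls the
  \<open>p^c\<close>-th powers of \<open>?R\<close>.\<close>

lemma lq_modular_step:
  assumes F: "bounded_gen p F K B" and N: "field_ext F N" "N \<subseteq> K" "lq_modular p F N"
    and G: "finite G" "G \<subseteq> K" "F \<subseteq> adjoin k G"
  shows "\<exists>G'\<subseteq>K. finite G' \<and> N \<subseteq> adjoin core_union G'"
proof -
  obtain F' where F': "field_ext F' N" "finite_ext F F'" "modular p F' N" using N(3) by (auto simp: lq_modular_def)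
  have sf: "subfield F" "subfield F'" "subfield N" "F \<subseteq> F'" "F' \<subseteq> N"
    using F' N by (auto simp: field_ext_def finite_ext_iff)
  have F'K: "F' \<subseteq> K" using sf N by auto
  obtain S where S: "S \<subseteq> F'" "finite S" "adjoin F S = F'" using finite_ext_adjoin[OF F'(2)] by blast
  let ?G = "G \<union> S"
  have G1: "finite ?G" "?G \<subseteq> K" using G S F'K by auto
  have F'G: "F' \<subseteq> adjoin k ?G"
    using S(3) adjoin_mono[OF G(3) order_refl[of S]] by (simp add: adjoin_adjoin)
  obtain c where "pow_set (p ^ c) (adjoin k ?G) \<subseteq> k"
    using fin_dim_exponent[OF adjoin_fin_dim[OF G1] adjoin_sub[OF G1(2)]] by blast
  hence c: "pow_set (p ^ c) F' \<subseteq> k" using pow_set_mono[OF F'G] by blast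
  interpret F: bounded_gen p F K B by (rule F)
  interpret F': bounded_gen p F' K B by (intro F.bounded_gen_base sf F'K)
  have insep': "purely_insep p F' N"
    using F'.insep_ex N(2) sf unfolding purely_insep_def field_ext_def by blast
  obtain d G2 where d: "finite G2" "G2 \<subseteq> N" "N \<subseteq> adjoin (kpow p F' d N) G2"
    "\<And>j. kpow p F' (d + j) N = kpow p F' d N"
    using F'.kpow_stable[OF sf(3,5) N(2)] by blast
  let ?R = "kpow p F' d N" and ?E = "adjoin core_union ?G"
  have "x ^ (p ^ c) \<in> core_union" if x: "x \<in> ?R" for x
  proof (rule modular_core[OF insep' F'(3) c N(2)])
    show "x \<in> N" using x F'.kpow_subset[OF sf(3,5)] by blast
    show "x \<in> kpow p F' j N" for j
      using x d(4)[of j] F'.kpow_antimono[OF sf(3) N(2), of j "d + j"] by auto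
  qed
  hence "pow_set (p ^ c) ?R \<subseteq> ?E" using adjoin_superset(1) by (auto simp: pow_set_def)
  moreover have "F' \<subseteq> ?E" using F'G adjoin_mono[OF core_union_superset order_refl] by blast
  ultimately have "kpow p F' c ?R \<subseteq> ?E" unfolding kpow_def[of p F' c] by (intro lspan_in_subfield subfield_adjoin)
  \<comment> \<open>Stability at \<open>d + c\<close> gives
    \<open>?R = F'(?R^(p^c))\<close>.\<close>
  hence "?R \<subseteq> ?E" using d(4)[of c] by (simp add: F'.kpow_kpow add.commute)
  hence "N \<subseteq> adjoin core_union (?G \<union> G2)"
    using d(3) adjoin_mono[of ?R ?E G2 G2] unfolding adjoin_adjoin by blast
  thus ?thesis using G1 d(1,2) N(2) by (intro exI[of _ "?G \<union> G2"]) auto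
qed

section \<open>The sequence \<open>H_i\<close> and chains of lq-modular steps\<close>

lemma Hseq_between: "subfield (Hseq p k K i) \<and> k \<subseteq> Hseq p k K i \<and> Hseq p k K i \<subseteq> K"
proof (induction i)
  case 0 thus ?case by (simp add: sf_k k_sub)
next
  case (Suc i)
  then interpret H: bounded_gen p "Hseq p k K i" K B by (intro bounded_gen_base) auto
  show ?case
    using Suc H.Hmax_eq_core_union H.core_union_subfield H.core_union_superset H.core_union_sub_K sf_K k_sub by auto
qed

lemma bounded_gen_Hseq: "bounded_gen p (Hseq p k K i) K B"
  using Hseq_between by (intro bounded_gen_base) auto

text \<open>As \<open>Hseq p k K i\<close> is contained in \<open>K\<close>, the reverse alternative
  of \<open>equiv_fin\<close> forces equality.\<close>

lemma equiv_fin_Hseq: "Hseq p k K i \<sim>\<^sub>f K \<longleftrightarrow> finite_ext (Hseq p k K i) K"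
proof -
  have "Hseq p k K i = K" if "finite_ext K (Hseq p k K i)"
    using that Hseq_between[of i] by (auto simp: finite_ext_def field_ext_def)
  thus ?thesis by (auto simp: equiv_fin_def)
qed

lemma i_modular_imp_finite:
  assumes "i_modular p k K i" shows "finite_ext (Hseq p k K i) K"
proof -
  obtain F where F: "F 0 = k" "F i = K" "\<And>j. j < i \<Longrightarrow> field_ext (F j) (F (Suc j))"
    "\<And>j. j < i \<Longrightarrow> lq_modular p (F j) (F (Suc j))"
    using assms unfolding i_modular_def by blast
  have kF: "subfield (F j) \<and> k \<subseteq> F j" if "j \<le> i" for j
    using that by (induction j) (use F(1) sf_k F(3) in \<open>auto simp: field_ext_def dest!: Suc_le_lessD\<close>)
  \<comment> \<open>Induction runs downwards, from \<open>F i = K\<close>.\<close>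
  have FK: "F j \<subseteq> K" if "j \<le> i" for j
    using that by (induction rule: inc_induct) (use F(2,3) in \<open>auto simp: field_ext_def\<close>)
  have "\<exists>G\<subseteq>K. finite G \<and> F j \<subseteq> adjoin (Hseq p k K j) G" if "j \<le> i" for j
    using that
  proof (induction j)
    case 0 thus ?case using F(1) adjoin_superset(1)[of k "{}"] by (intro exI[of _ "{}"]) auto
  next
    case (Suc j)
    then obtain G where G: "G \<subseteq> K" "finite G" "F j \<subseteq> adjoin (Hseq p k K j) G" by auto
    interpret H: bounded_gen p "Hseq p k K j" K B by (rule bounded_gen_Hseq)
    have Fj: "bounded_gen p (F j) K B" using kF[of j] FK[of j] Suc.prems by (intro bounded_gen_base) auto
    show ?case
    proof (cases "finite_ext (Hseq p k K j) K")
      \<comment> \<open>Here \<open>H_(j+1)\<close> is \<open>K\<close> by definition, so no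
        generators are needed.\<close>
      case True
      thus ?thesis using FK[OF Suc.prems] adjoin_superset(1)[of K "{}"] by (intro exI[of _ "{}"]) auto
    next
      case False
      thus ?thesis
        using H.lq_modular_step[OF Fj F(3) FK[OF Suc.prems] F(4) G(2,1,3)] Suc.prems
        by (simp add: H.Hmax_eq_core_union)
    qed
  qed
  from this[of i] obtain G where G: "G \<subseteq> K" "finite G" "K \<subseteq> adjoin (Hseq p k K i) G" using F(2) by auto
  interpret H: bounded_gen p "Hseq p k K i" K B by (rule bounded_gen_Hseq)
  show ?thesis using H.finite_extI G by blast
qed

lemma finite_imp_i_modular:
  assumes fin: "finite_ext (Hseq p k K i) K" and unb: "unbounded_exponent p k K"
  shows "i_modular p k K i"
proof -
  let ?H = "Hseq p k K" and ?P = "\<lambda>j. finite_ext (Hseq p k K j) K"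
  \<comment> \<open>Before the least such index, each \<open>H_(l+1)\<close> is given by
    \<open>Hmax\<close> and not by the convention that sets it to \<open>K\<close>.\<close>
  define j where "j = (LEAST j. ?P j)"
  have j: "?P j" "j \<le> i" "\<And>l. l < j \<Longrightarrow> \<not> ?P l"
    unfolding j_def using fin by (auto intro: LeastI Least_le dest: not_less_Least)
  \<comment> \<open>Unbounded exponent excludes \<open>j = 0\<close>, so the chain can start at
    \<open>k\<close> and there is a preceding field \<open>H_(j-1)\<close>.\<close>
  have "\<not> fin_dim k K" using unb fin_dim_exponent[of K] by (force simp: unbounded_exponent_def pow_set_def)
  hence "j \<noteq> 0" using j(1) by (auto simp: finite_ext_iff intro!: Nat.gr0I)
  \<comment> \<open>\<open>H_j\<close> itself is replaced by \<open>K\<close>: the finite rest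
    \<open>K/H_j\<close> is absorbed into the step from \<open>H_(j-1)\<close> instead of costing a
    step of its own.\<close>
  let ?F = "\<lambda>l. if l < j then ?H l else K"
  have "field_ext (?F l) (?F (Suc l)) \<and> lq_modular p (?F l) (?F (Suc l))" for l
  proof (cases "l < j")
    case False thus ?thesis using lq_modular_self sf_K by (simp add: field_ext_def)
  next
    case True
    interpret H: bounded_gen p "?H l" K B by (rule bounded_gen_Hseq)
    have HS: "?H (Suc l) = H.core_union" using j(3)[OF True] by (simp add: H.Hmax_eq_core_union)
    show ?thesis
    proof (cases "Suc l < j")
      case True
      thus ?thesis using HS H.sf_k H.core_union_subfield H.core_union_superset H.lq_modular_core_union
        by (simp add: field_ext_def del: Hseq.simps)
    next
      case False
      hence "Suc l = j" using True by simp
      then obtain G where "G \<subseteq> K" "finite G" "adjoin H.core_union G = K"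
        using finite_ext_adjoin[OF j(1)] HS by auto
      hence "lq_modular p (?H l) K" using H.lq_modular_adjoin_core_union by metis
      thus ?thesis using True False H.sf_k H.sf_K H.k_sub by (simp add: field_ext_def del: Hseq.simps)
    qed
  qed
  moreover have "?F 0 = k" "?F i = K" using \<open>j \<noteq> 0\<close> j(2) by auto
  ultimately show ?thesis unfolding i_modular_def by (intro exI[of _ ?F]) blast
qed

end

theorem mainTheorem16:
  fixes k K :: "'a::field set" and p i :: nat
  assumes "prime p" and "of_nat p = (0::'a)"
    and "purely_insep p k K"
    and "q_finite p k K"
    and "unbounded_exponent p k K"
  shows "(i_modular p k K i \<longleftrightarrow> Hseq p k K i \<sim>\<^sub>f K)
    \<and> dm p k K = (if \<exists>j. Hseq p k K j \<sim>\<^sub>f K then enat (LEAST j. Hseq p k K j \<sim>\<^sub>f K) else \<infinity>)"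
proof -
  interpret pins p k K using assms(1-3) by unfold_locales
  obtain B where "bounded_gen p k K B" using bounded_gen_q_finite[OF assms(4)] by blast
  then interpret bounded_gen p k K B .
  \<comment> \<open>Equality is needed as predicates, not only at \<open>i\<close>, because
    \<open>dm\<close> takes the least index over all of them.\<close>
  have "i_modular p k K = (\<lambda>j. Hseq p k K j \<sim>\<^sub>f K)"
    unfolding equiv_fin_Hseq using i_modular_imp_finite finite_imp_i_modular assms(5) by blast
  thus ?thesis by (simp add: dm_def)
qed

end
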